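(* Let $\Gamma$ be a connected, locally finite, accessible graph such that $\mathrm{Aut}(\Gamma)$ acts on $\Gamma$ with finitely many orbits. Then for every optimal cut $C\in\mathcal{C}_{\mathrm{opt}}$ the block $B[C]$ has at most one end.
   Context: Graphs are undirected, without loops and multiple edges. A graph has more than one end if there is a finite set $S$ of vertices such that removing $S$ leaves at least two infinite connected components; otherwise it has at most one end. A subset of $V(\Gamma)$ is identified with the subgraph it induces. Cuts. For $C\subseteq V(\Gamma)$ write $\overline{C}=V(\Gamma)\setminus C$ and $\delta C=\{uv\in E(\Gamma): u\in C, v\in\overline{C}\}$. A cut is a subset $C\subseteq V(\Gamma)$ such that $C$ and $\overline{C}$ are non-empty and induce connected subgraphs, and $\delta C$ is finite. A $k$-cut is a cut with $|\delta C|\le k$. Cuts $C,D$ are nested if one of $C\subseteq D$, $C\subseteq\overline{D}$, $\overline{C}\subseteq D$, $\overline{C}\subseteq\overline{D}$ holds. A bi-infinite simple path $\alpha$ is a sequence $(v_i)_{i\in\mathbb{Z}}$ of pairwise distinct vertices with $v_iv_{i+1}\in E(\Gamma)$; $\alpha\cap C$ denotes the set of its vertices in $C$. Put $\mathcal{C}(\alpha)=\{C : C \text{ is a cut and } |\alpha\cap C|=\infty=|\alpha\cap\overline{C}|\}$ and $\mathcal{C}_{\min}(\alpha)=\{C\in\mathcal{C}(\alpha): |\delta C| \text{ is minimal in } \mathcal{C}(\alpha)\}$. $\Gamma$ is accessible if there is $k\in\mathbb{N}$ such that for every bi-infinite simple path $\alpha$ either $\mathcal{C}(\alpha)=\emptyset$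 or $\mathcal{C}(\alpha)$ contains a $k$-cut. Optimal cuts. Fix such a $k$. For a cut $C$ let $m(C)$ be the (finite) number of $k$-cuts $D$ that are not nested with $C$. For a bi-infinite simple path $\alpha$ with $\mathcal{C}(\alpha)\neq\emptyset$ let $m_\alpha=\min\{m(C): C\in\mathcal{C}_{\min}(\alpha)\}$ and $\mathcal{C}_{\mathrm{opt}}(\alpha)=\{C\in\mathcal{C}_{\min}(\alpha): m(C)=m_\alpha\}$ (and $\mathcal{C}_{\mathrm{opt}}(\alpha)=\emptyset$ if $\mathcal{C}(\alpha)=\emptyset$). Then $\mathcal{C}_{\mathrm{opt}}=\bigcup_\alpha \mathcal{C}_{\mathrm{opt}}(\alpha)$ over all bi-infinite simple paths $\alpha$; its elements are called optimal cuts. For $C,D\in\mathcal{C}_{\mathrm{opt}}$ let $C\sim D$ if either $C=D$, or both $\overline{C}\subsetneq D$ and for all $E\in\mathcal{C}_{\mathrm{opt}}$: $\overline{C}\subsetneq E\subseteq D$ implies $D=E$. This is an equivalence relation with classes $[C]$. Blocks. For $S\subseteq V(\Gamma)$ and $j\ge1$ let $N^jS=\{v\in V(\Gamma): d(v,S)\le j\}$. Fix $\kappa\ge1$ such that $N^\kappa C\cap\overline{C}$ is connected for all $C\in\mathcal{C}_{\mathrm{opt}}$ (such $\kappa$ exists because there are only finitely many $\mathrm{Aut}(\Gamma)$-orbits of optimal cuts). The block assigned to $[C]$ is $B[C]=\bigcap_{D\sim C}N^\kappa D$. *)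

theory Defs
  imports Main "HOL-Library.Extended_Nat"
begin

section \<open>Graphs\<close>

record 'a ugraph =
  verts :: "'a set"
  edges :: "'a set set"

definition simple_graph :: "'a ugraph \<Rightarrow> bool" where
  "simple_graph G \<longleftrightarrow> (\<forall>e\<in>edges G. \<exists>u\<in>verts G. \<exists>v\<in>verts G. u \<noteq> v \<and> e = {u, v})"

definition adj :: "'a ugraph \<Rightarrow> ('a \<times> 'a) set" where
  "adj G = {(u, v). u \<in> verts G \<and> v \<in> verts G \<and> {u, v} \<in> edges G}"

definition induced :: "'a ugraph \<Rightarrow> 'a set \<Rightarrow> 'a ugraph" where
  "induced G S = \<lparr>verts = verts G \<inter> S, edges = {e \<in> edges G. e \<subseteq> S}\<rparr>"

definition connected_graph :: "'a ugraph \<Rightarrow> bool" where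
  "connected_graph G \<longleftrightarrow> (\<forall>u\<in>verts G. \<forall>v\<in>verts G. (u, v) \<in> (adj G)\<^sup>*)"

definition locally_finite :: "'a ugraph \<Rightarrow> bool" where
  "locally_finite G \<longleftrightarrow> (\<forall>v\<in>verts G. finite {u. (v, u) \<in> adj G})"

definition graph_components :: "'a ugraph \<Rightarrow> 'a set set" where
  "graph_components G = (\<lambda>v. {u. (v, u) \<in> (adj G)\<^sup>*}) ` verts G"

definition more_than_one_end :: "'a ugraph \<Rightarrow> bool" where
  "more_than_one_end G \<longleftrightarrow>
     (\<exists>S \<subseteq> verts G. finite S \<and>
        (\<exists>A \<in> graph_components (induced G (verts G - S)).
         \<exists>B \<in> graph_components (induced G (verts G - S)).
           A \<noteq> B \<and> infinite A \<and> infinite B))"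

abbreviation at_most_one_end :: "'a ugraph \<Rightarrow> bool" where
  "at_most_one_end G \<equiv> \<not> more_than_one_end G"

text \<open>Only the values on the vertex set matter; outside it an automorphism is arbitrary,
  which does not affect the orbits.\<close>

definition automorphisms :: "'a ugraph \<Rightarrow> ('a \<Rightarrow> 'a) set" where
  "automorphisms G = {f. bij_betw f (verts G) (verts G) \<and>
     (\<forall>u\<in>verts G. \<forall>v\<in>verts G. {f u, f v} \<in> edges G \<longleftrightarrow> {u, v} \<in> edges G)}"

definition aut_orbits :: "'a ugraph \<Rightarrow> 'a set set" where
  "aut_orbits G = (\<lambda>v. (\<lambda>f. f v) ` automorphisms G) ` verts G"

text \<open>Distances are infinite between vertices that are not joined by a walk, and
  the distance to the empty set is infinite.\<close>

definition graph_dist :: "'a ugraph \<Rightarrow> 'a \<Rightarrow> 'a \<Rightarrow> enat" where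
  "graph_dist G u v = (INF n \<in> {n. (u, v) \<in> adj G ^^ n}. enat n)"

definition set_dist :: "'a ugraph \<Rightarrow> 'a \<Rightarrow> 'a set \<Rightarrow> enat" where
  "set_dist G v S = (INF s\<in>S. graph_dist G v s)"

definition nbhd :: "'a ugraph \<Rightarrow> nat \<Rightarrow> 'a set \<Rightarrow> 'a set" where
  "nbhd G j S = {v \<in> verts G. set_dist G v S \<le> enat j}"


section \<open>Cuts\<close>

abbreviation compl_in :: "'a ugraph \<Rightarrow> 'a set \<Rightarrow> 'a set" where
  "compl_in G C \<equiv> verts G - C"

definition boundary :: "'a ugraph \<Rightarrow> 'a set \<Rightarrow> 'a set set" where
  "boundary G C = {{u, v} | u v. {u, v} \<in> edges G \<and> u \<in> C \<and> v \<in> compl_in G C}"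

definition is_cut :: "'a ugraph \<Rightarrow> 'a set \<Rightarrow> bool" where
  "is_cut G C \<longleftrightarrow> C \<subseteq> verts G \<and> C \<noteq> {} \<and> compl_in G C \<noteq> {} \<and>
     connected_graph (induced G C) \<and> connected_graph (induced G (compl_in G C)) \<and>
     finite (boundary G C)"

definition is_k_cut :: "'a ugraph \<Rightarrow> nat \<Rightarrow> 'a set \<Rightarrow> bool" where
  "is_k_cut G k C \<longleftrightarrow> is_cut G C \<and> card (boundary G C) \<le> k"

definition nested :: "'a ugraph \<Rightarrow> 'a set \<Rightarrow> 'a set \<Rightarrow> bool" where
  "nested G C D \<longleftrightarrow> C \<subseteq> D \<or> C \<subseteq> compl_in G D \<or> compl_in G C \<subseteq> D \<or> compl_in G C \<subseteq> compl_in G D"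

definition biinfinite_path :: "'a ugraph \<Rightarrow> (int \<Rightarrow> 'a) \<Rightarrow> bool" where
  "biinfinite_path G \<alpha> \<longleftrightarrow> inj \<alpha> \<and> range \<alpha> \<subseteq> verts G \<and> (\<forall>i. {\<alpha> i, \<alpha> (i + 1)} \<in> edges G)"

definition path_cuts :: "'a ugraph \<Rightarrow> (int \<Rightarrow> 'a) \<Rightarrow> 'a set set" where
  "path_cuts G \<alpha> = {C. is_cut G C \<and> infinite (range \<alpha> \<inter> C) \<and> infinite (range \<alpha> \<inter> compl_in G C)}"

definition min_cuts :: "'a ugraph \<Rightarrow> (int \<Rightarrow> 'a) \<Rightarrow> 'a set set" where
  "min_cuts G \<alpha> = {C \<in> path_cuts G \<alpha>.
     \<forall>D \<in> path_cuts G \<alpha>. card (boundary G C) \<le> card (boundary G D)}"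

definition accessible_with :: "'a ugraph \<Rightarrow> nat \<Rightarrow> bool" where
  "accessible_with G k \<longleftrightarrow>
     (\<forall>\<alpha>. biinfinite_path G \<alpha> \<longrightarrow> path_cuts G \<alpha> = {} \<or> (\<exists>C \<in> path_cuts G \<alpha>. is_k_cut G k C))"

definition accessible :: "'a ugraph \<Rightarrow> bool" where
  "accessible G \<longleftrightarrow> (\<exists>k. accessible_with G k)"


section \<open>Optimal cuts and blocks\<close>

text \<open>For a cut \<open>C\<close> of a connected locally finite graph the set counted here is finite,
  so \<open>card\<close> is the genuine cardinality.\<close>

definition num_crossing :: "'a ugraph \<Rightarrow> nat \<Rightarrow> 'a set \<Rightarrow> nat" where
  "num_crossing G k C = card {D. is_k_cut G k D \<and> \<not> nested G C D}"

text \<open>If there are no cuts separating \<open>\<alpha>\<close>, the value of \<open>min_crossing\<close> is irrelevant and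
  \<open>path_opt_cuts\<close> is empty.\<close>

definition min_crossing :: "'a ugraph \<Rightarrow> nat \<Rightarrow> (int \<Rightarrow> 'a) \<Rightarrow> nat" where
  "min_crossing G k \<alpha> = (LEAST n. n \<in> num_crossing G k ` min_cuts G \<alpha>)"

definition path_opt_cuts :: "'a ugraph \<Rightarrow> nat \<Rightarrow> (int \<Rightarrow> 'a) \<Rightarrow> 'a set set" where
  "path_opt_cuts G k \<alpha> = {C \<in> min_cuts G \<alpha>. num_crossing G k C = min_crossing G k \<alpha>}"

definition opt_cuts :: "'a ugraph \<Rightarrow> nat \<Rightarrow> 'a set set" where
  "opt_cuts G k = (\<Union>\<alpha> \<in> {\<alpha>. biinfinite_path G \<alpha>}. path_opt_cuts G k \<alpha>)"

definition opt_equiv :: "'a ugraph \<Rightarrow> nat \<Rightarrow> 'a set \<Rightarrow> 'a set \<Rightarrow> bool" where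
  "opt_equiv G k C D \<longleftrightarrow> C \<in> opt_cuts G k \<and> D \<in> opt_cuts G k \<and>
     (C = D \<or>
      (compl_in G C \<subset> D \<and>
       (\<forall>E \<in> opt_cuts G k. compl_in G C \<subset> E \<and> E \<subseteq> D \<longrightarrow> D = E)))"

definition opt_class :: "'a ugraph \<Rightarrow> nat \<Rightarrow> 'a set \<Rightarrow> 'a set set" where
  "opt_class G k C = {D. opt_equiv G k D C}"

definition block :: "'a ugraph \<Rightarrow> nat \<Rightarrow> 'a set set \<Rightarrow> 'a set" where
  "block G \<kappa> K = (\<Inter>D\<in>K. nbhd G \<kappa> D)"

end

theory Submission imports Defs "HOL.Filter" begin

text \<open>If the block of \<open>C\<close> had two ends, it would contain rays in two infinite components of the
  block minus a finite set. Enlarge this set by the finitely many frontiers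
  \<open>N\<^sup>\<kappa>D - D\<close> with \<open>D \<sim> C\<close> that meet it: since frontiers are connected and lie in the block,
  excursions outside the block can be rerouted, so the enlarged finite set separates the rays in the
  whole graph. Joining the rays gives a bi-infinite path \<open>\<alpha>\<close> which is split by some cut, hence by
  an optimal cut \<open>E\<close>. Both tails of \<open>\<alpha>\<close> lie in every \<open>D \<sim> C\<close>, because frontiers are finite. As
  optimal cuts are nested, \<open>E\<close> or its complement is properly contained in \<open>C\<close>; say \<open>E\<close> is. An
  inclusion-minimal optimal cut \<open>F\<close> between the complements of \<open>C\<close> and \<open>E\<close> is
  equivalent to \<open>C\<close>, so it contains both tails of \<open>\<alpha>\<close>, although one of them lies in \<open>E\<close>.\<close>

section \<open>Walks and boundaries\<close>

lemma sym_adj: "sym (adj G)"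
  by (auto simp: sym_def adj_def insert_commute)

lemma adj_verts: "(u, v) \<in> adj G \<Longrightarrow> u \<in> verts G \<and> v \<in> verts G"
  by (auto simp: adj_def)

lemma verts_induced [simp]: "verts (induced G S) = verts G \<inter> S"
  by (simp add: induced_def)

lemma adj_induced [simp]: "adj (induced G S) = adj G \<inter> S \<times> S"
  by (auto simp: adj_def induced_def)

lemma sym_rtrancl_adj_within: "sym ((adj G \<inter> S \<times> S)\<^sup>*)"
proof -
  have "sym (adj G \<inter> S \<times> S)" using sym_adj[of G] by (auto simp: sym_def)
  then show ?thesis by (rule sym_rtrancl)
qed

lemma connected_induced_if_reachable:
  assumes "\<And>z. z \<in> S \<Longrightarrow> (x, z) \<in> (adj G \<inter> S \<times> S)\<^sup>*"
  shows "connected_graph (induced G S)"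
  unfolding connected_graph_def
proof (intro ballI)
  fix u v assume "u \<in> verts (induced G S)" "v \<in> verts (induced G S)"
  then have "(x, u) \<in> (adj G \<inter> S \<times> S)\<^sup>*" "(x, v) \<in> (adj G \<inter> S \<times> S)\<^sup>*"
    using assms by auto
  then show "(u, v) \<in> (adj (induced G S))\<^sup>*"
    using sym_rtrancl_adj_within[of G S] by (auto dest: symD intro: rtrancl_trans)
qed

lemma edge_verts:
  assumes "simple_graph G" "{u, v} \<in> edges G"
  shows "u \<in> verts G" "v \<in> verts G" "u \<noteq> v"
proof -
  obtain a b where "a \<in> verts G" "b \<in> verts G" "a \<noteq> b" "{u, v} = {a, b}"
    using assms unfolding simple_graph_def by blast
  then show "u \<in> verts G" "v \<in> verts G" "u \<noteq> v" by (auto simp: doubleton_eq_iff)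
qed

lemma edge_in_boundary_iff:
  assumes "simple_graph G" "{u, v} \<in> edges G"
  shows "{u, v} \<in> boundary G S \<longleftrightarrow> (u \<in> S) \<noteq> (v \<in> S)"
proof -
  have "u \<in> verts G" "v \<in> verts G"
    using edge_verts[OF assms] by auto
  moreover have "{v, u} = {u, v}" by (rule insert_commute)
  ultimately show ?thesis
    using assms(2) unfolding boundary_def
    by (smt (verit) DiffD2 DiffI doubleton_eq_iff mem_Collect_eq)
qed

lemma boundary_subset_edges: "boundary G S \<subseteq> edges G"
  by (auto simp: boundary_def)

lemma edges_adj:
  assumes "simple_graph G" "e \<in> edges G"
  obtains u v where "e = {u, v}" "(u, v) \<in> adj G"
  using assms unfolding simple_graph_def adj_def by fastforce

lemma boundary_subsetI:
  assumes "simple_graph G"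
    and "\<And>u v. (u, v) \<in> adj G \<Longrightarrow> u \<in> S \<Longrightarrow> v \<notin> S \<Longrightarrow> (u \<in> T) \<noteq> (v \<in> T)"
  shows "boundary G S \<subseteq> boundary G T"
proof
  fix e assume e: "e \<in> boundary G S"
  then obtain u v where uv: "e = {u, v}" "{u, v} \<in> edges G" "u \<in> S" "v \<in> compl_in G S"
    by (auto simp: boundary_def)
  then have "(u, v) \<in> adj G" using edge_verts[OF assms(1) uv(2)] by (simp add: adj_def)
  then show "e \<in> boundary G T"
    using assms uv edge_in_boundary_iff[OF assms(1) uv(2)] by blast
qed

lemma boundary_compl:
  assumes "simple_graph G" shows "boundary G (compl_in G S) = boundary G S"
proof -
  have "boundary G (compl_in G S) \<subseteq> boundary G S" 
    by (rule boundary_subsetI[OF assms]) (auto dest: adj_verts)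
  moreover have "boundary G S \<subseteq> boundary G (compl_in G S)" 
    by (rule boundary_subsetI[OF assms]) (auto dest: adj_verts)
  ultimately show ?thesis by simp
qed

lemma boundary_corners_Un:
  assumes "simple_graph G"
  shows "boundary G (S \<inter> T) \<union> boundary G (compl_in G S \<inter> compl_in G T)
    \<subseteq> boundary G S \<union> boundary G T"
proof
  fix e assume e: "e \<in> boundary G (S \<inter> T) \<union> boundary G (compl_in G S \<inter> compl_in G T)"
  then have "e \<in> edges G" using boundary_subset_edges by blast
  from edges_adj[OF assms this] obtain u v where uv: "e = {u, v}" "(u, v) \<in> adj G" .
  then have "{u, v} \<in> edges G" by (simp add: adj_def)
  from edge_in_boundary_iff[OF assms this] e adj_verts[OF uv(2)]
  show "e \<in> boundary G S \<union> boundary G T" unfolding uv(1) by auto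
qed

lemma boundary_corners_Int:
  assumes "simple_graph G"
  shows "boundary G (S \<inter> T) \<inter> boundary G (compl_in G S \<inter> compl_in G T)
    \<subseteq> boundary G S \<inter> boundary G T"
proof
  fix e assume e: "e \<in> boundary G (S \<inter> T) \<inter> boundary G (compl_in G S \<inter> compl_in G T)"
  then have "e \<in> edges G" using boundary_subset_edges by blast
  from edges_adj[OF assms this] obtain u v where uv: "e = {u, v}" "(u, v) \<in> adj G" .
  then have "{u, v} \<in> edges G" by (simp add: adj_def)
  from edge_in_boundary_iff[OF assms this] e adj_verts[OF uv(2)]
  show "e \<in> boundary G S \<inter> boundary G T" unfolding uv(1) by auto
qed

lemma finite_boundary_corner:
  assumes "simple_graph G" "finite (boundary G S)" "finite (boundary G T)"
  shows "finite (boundary G (S \<inter> T))"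
  using boundary_corners_Un[OF assms(1), of S T] assms(2,3)
  by (meson finite_UnI finite_subset le_sup_iff)

text \<open>Submodularity of edge boundaries, by inclusion-exclusion: an edge in both corner
  boundaries joins the two opposite corners, hence crosses both \<open>S\<close> and
  \<open>T\<close>.\<close>

lemma card_boundary_corners:
  assumes "simple_graph G" "finite (boundary G S)" "finite (boundary G T)"
  shows "card (boundary G (S \<inter> T)) + card (boundary G (compl_in G S \<inter> compl_in G T))
    \<le> card (boundary G S) + card (boundary G T)"
proof -
  let ?A = "boundary G (S \<inter> T)" and ?B = "boundary G (compl_in G S \<inter> compl_in G T)"
  have fin: "finite (boundary G S \<union> boundary G T)" using assms by simp
  then have "finite ?A" "finite ?B"
    using boundary_corners_Un[OF assms(1), of S T] by (meson finite_subset le_sup_iff)+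
  then have "card ?A + card ?B = card (?A \<union> ?B) + card (?A \<inter> ?B)" by (rule card_Un_Int)
  also have "\<dots> \<le> card (boundary G S \<union> boundary G T) + card (boundary G S \<inter> boundary G T)"
    using fin boundary_corners_Un[OF assms(1), of S T] boundary_corners_Int[OF assms(1), of S T]
    by (intro add_mono card_mono) auto
  also have "\<dots> = card (boundary G S) + card (boundary G T)"
    using card_Un_Int[OF assms(2,3)] by simp
  finally show ?thesis .
qed

lemma walk_crosses:
  fixes f :: "nat \<Rightarrow> 'a"
  assumes "f 0 \<in> S" "f n \<notin> S"
  shows "\<exists>i<n. f i \<in> S \<and> f (Suc i) \<notin> S"
  using assms
proof (induction n)
  case (Suc n) then show ?case by (cases "f n \<in> S") (auto intro: less_SucI)
qed simp

lemma is_cut_compl: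
  assumes "simple_graph G"
  shows "is_cut G C \<Longrightarrow> is_cut G (compl_in G C)"
  using boundary_compl[OF assms] by (auto simp: is_cut_def double_diff)


section \<open>Finiteness properties of cuts\<close>

lemma cut_connected:
  assumes "is_cut G C" "x \<in> C" "z \<in> C"
  shows "(x, z) \<in> (adj G \<inter> C \<times> C)\<^sup>*"
proof -
  have "verts G \<inter> C = C" using assms(1) by (auto simp: is_cut_def)
  then show ?thesis using assms unfolding is_cut_def connected_graph_def by simp
qed

lemma cut_compl_connected:
  assumes "is_cut G C" "x \<in> compl_in G C" "z \<in> compl_in G C"
  shows "(x, z) \<in> (adj G \<inter> compl_in G C \<times> compl_in G C)\<^sup>*"
proof -
  have "verts G \<inter> compl_in G C = compl_in G C" by auto
  then show ?thesis using assms unfolding is_cut_def connected_graph_def by simp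
qed

text \<open>Deleting \<open>{x, y}\<close> leaves both sides of \<open>C\<close> connected, so a
  walk in \<open>H\<close> from \<open>x\<close> out of \<open>C\<close> would make all of
  \<open>H\<close> connected. Thus a bridge determines the side of the cut that contains
  \<open>x\<close>.\<close>

lemma cut_eq_bridge_component:
  fixes G :: "'a ugraph"
  assumes cut: "is_cut G C" and x: "x \<in> C" and y: "y \<in> compl_in G C"
  defines "H \<equiv> G\<lparr>edges := edges G - {{x, y}}\<rparr>"
  assumes disc: "\<not> connected_graph H"
  shows "C = {z. (x, z) \<in> (adj H)\<^sup>*}"
proof -
  have adjH: "adj H = {(u, v) \<in> adj G. {u, v} \<noteq> {x, y}}" by (auto simp: H_def adj_def)
  have "sym ((adj H)\<^sup>*)" by (rule sym_rtrancl) (rule sym_adj)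
  note sym = symD[OF this]
  have "adj G \<inter> C \<times> C \<subseteq> adj H" "adj G \<inter> compl_in G C \<times> compl_in G C \<subseteq> adj H"
    using x y by (auto simp: adjH doubleton_eq_iff)
  then have sub: "(adj G \<inter> C \<times> C)\<^sup>* \<subseteq> (adj H)\<^sup>*"
    "(adj G \<inter> compl_in G C \<times> compl_in G C)\<^sup>* \<subseteq> (adj H)\<^sup>*" by (auto intro!: rtrancl_mono)
  have inC: "(x, z) \<in> (adj H)\<^sup>*" if "z \<in> C" for z
    using cut_connected[OF cut x that] sub by blast
  have inD: "(y, z) \<in> (adj H)\<^sup>*" if "z \<in> compl_in G C" for z
    using cut_compl_connected[OF cut y that] sub by blast
  have "z \<in> C" if z: "(x, z) \<in> (adj H)\<^sup>*" for z
  proof (rule ccontr)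
    assume nz: "z \<notin> C"
    have "z \<in> verts G" using z x cut by (induction rule: rtrancl_induct) (auto simp: is_cut_def adjH dest: adj_verts)
    then have "(z, y) \<in> (adj H)\<^sup>*" using nz inD sym by blast
    with z have xy: "(x, y) \<in> (adj H)\<^sup>*" by (rule rtrancl_trans)
    have all: "(x, w) \<in> (adj H)\<^sup>*" if "w \<in> verts G" for w
      using that inC inD xy by (cases "w \<in> C") (auto intro: rtrancl_trans)
    have "verts H = verts G" by (simp add: H_def)
    then have "connected_graph H"
      unfolding connected_graph_def by (auto intro: rtrancl_trans[OF sym[OF all] all])
    with disc show False ..
  qed
  with inC show ?thesis by blast
qed

text \<open>Induction on \<open>k\<close>: a cut separating \<open>u\<close> from \<open>v\<close> contains an edge of a fixed walk from \<open>u\<close> to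
  \<open>v\<close>. Deleting that edge lowers the size of the boundary, or disconnects the graph and thereby
  determines the cut.\<close>

lemma finite_k_cuts_separating:
  fixes G :: "'a ugraph"
  assumes "simple_graph G" "connected_graph G" "v \<in> verts G"
  shows "finite {C. is_k_cut G k C \<and> u \<in> C \<and> v \<notin> C}"
  using assms
proof (induction k arbitrary: G u v)
  case (0 G u v)
  have False if C: "is_k_cut G 0 C" "u \<in> C" "v \<notin> C" for C
  proof -
    have "u \<in> verts G" "boundary G C = {}" using C by (auto simp: is_k_cut_def is_cut_def)
    then have "(u, v) \<in> (adj G)\<^sup>*" using "0.prems" by (auto simp: connected_graph_def)
    then have "v \<in> C" using C(2)
    proof (induction rule: rtrancl_induct)
      case (step y z)
      then have "{y, z} \<in> edges G" by (simp add: adj_def)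
      with edge_in_boundary_iff[OF "0.prems"(1) this, of C] step \<open>boundary G C = {}\<close> show ?case by auto
    qed
    with C show False by simp
  qed
  then have empty: "{C. is_k_cut G 0 C \<and> u \<in> C \<and> v \<notin> C} = {}" by blast
  show ?case unfolding empty by simp
next
  case (Suc k G u v)
  have edge: "finite {C. is_k_cut G (Suc k) C \<and> x \<in> C \<and> y \<notin> C}" if xy: "(x, y) \<in> adj G" for x y
  proof -
    define H where "H = G\<lparr>edges := edges G - {{x, y}}\<rparr>"
    have adjH: "adj H = {(u, v) \<in> adj G. {u, v} \<noteq> {x, y}}" by (auto simp: H_def adj_def)
    have vH: "verts H = verts G" by (simp add: H_def)
    have xyV: "x \<in> verts G" "y \<in> verts G" using adj_verts[OF xy] by auto
    have xyE: "{x, y} \<in> edges G" using xy by (simp add: adj_def)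
    show ?thesis
    proof (cases "connected_graph H")
      case True
      have "simple_graph H" using Suc.prems(1) by (auto simp: H_def simple_graph_def)
      then have "finite {C. is_k_cut H k C \<and> x \<in> C \<and> y \<notin> C}"
        using Suc.IH True vH xyV by simp
      moreover have "is_k_cut H k C" if C: "is_k_cut G (Suc k) C" "x \<in> C" "y \<notin> C" for C
      proof -
        have bd: "boundary H C = boundary G C - {{x, y}}"
          by (auto simp: boundary_def H_def)
        have "{x, y} \<in> boundary G C"
          using edge_in_boundary_iff[OF Suc.prems(1) xyE] C by auto
        then have card: "card (boundary H C) \<le> k"
          using C(1) by (auto simp: bd is_k_cut_def is_cut_def card_Diff_singleton)
        have "adj H \<inter> C \<times> C = adj G \<inter> C \<times> C"
          "adj H \<inter> compl_in G C \<times> compl_in G C = adj G \<inter> compl_in G C \<times> compl_in G C"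
          using C by (auto simp: adjH doubleton_eq_iff)
        then have "is_cut H C"
          using C(1) unfolding is_k_cut_def is_cut_def connected_graph_def vH bd
            verts_induced adj_induced by auto
        with card show ?thesis by (simp add: is_k_cut_def)
      qed
      ultimately show ?thesis by (auto elim: rev_finite_subset)
    next
      case False
      have "C = {z. (x, z) \<in> (adj H)\<^sup>*}" if "is_k_cut G (Suc k) C" "x \<in> C" "y \<notin> C" for C
        unfolding H_def using that xyV False[unfolded H_def]
        by (intro cut_eq_bridge_component) (auto simp: is_k_cut_def)
      then have "{C. is_k_cut G (Suc k) C \<and> x \<in> C \<and> y \<notin> C} \<subseteq> {{z. (x, z) \<in> (adj H)\<^sup>*}}" by blast
      then show ?thesis by (rule finite_subset) simp
    qed
  qed
  show ?case
  proof (cases "u \<in> verts G")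
    case False
    then have empty: "{C. is_k_cut G (Suc k) C \<and> u \<in> C \<and> v \<notin> C} = {}"
      by (auto simp: is_k_cut_def is_cut_def)
    show ?thesis unfolding empty by simp
  next
    case True
    then have "(u, v) \<in> (adj G)\<^sup>*" using Suc.prems by (auto simp: connected_graph_def)
    then obtain n where "(u, v) \<in> adj G ^^ n" using rtrancl_power by blast
    then obtain f where f: "f 0 = u" "f n = v" "\<And>i. i < n \<Longrightarrow> (f i, f (Suc i)) \<in> adj G"
      unfolding relpow_fun_conv by blast
    have "{C. is_k_cut G (Suc k) C \<and> u \<in> C \<and> v \<notin> C}
      \<subseteq> (\<Union>i<n. {C. is_k_cut G (Suc k) C \<and> f i \<in> C \<and> f (Suc i) \<notin> C})"
      using walk_crosses[of f _ n] f by fastforce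
    moreover have "finite (\<Union>i<n. {C. is_k_cut G (Suc k) C \<and> f i \<in> C \<and> f (Suc i) \<notin> C})"
      using edge f(3) by blast
    ultimately show ?thesis by (rule finite_subset)
  qed
qed

lemma finite_Union_boundary:
  assumes "simple_graph G" "finite (boundary G C)"
  shows "finite (\<Union> (boundary G C))"
  using assms boundary_subset_edges[of G C]
  by (intro finite_Union) (auto simp: simple_graph_def subset_iff)

text \<open>A walk inside \<open>D\<close> from \<open>C\<close> to its complement uses an edge of
  \<open>boundary G C\<close>, and both ends of that edge lie in \<open>D\<close>.\<close>

lemma connected_set_meets_boundary:
  assumes "simple_graph G" "connected_graph (induced G D)" "D \<subseteq> verts G"
    and "D \<inter> C \<noteq> {}" "D - C \<noteq> {}"
  shows "D \<inter> \<Union> (boundary G C) \<noteq> {}"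
proof -
  obtain x y where xy: "x \<in> D" "x \<in> C" "y \<in> D" "y \<notin> C" using assms(4,5) by blast
  then have "(x, y) \<in> (adj G \<inter> D \<times> D)\<^sup>*" using assms(2,3) by (auto simp: connected_graph_def)
  then have "y \<in> C \<or> D \<inter> \<Union> (boundary G C) \<noteq> {}" using xy(2)
  proof (induction rule: rtrancl_induct)
    case (step y z)
    then have yz: "{y, z} \<in> edges G" "z \<in> D" by (auto simp: adj_def)
    show ?case
    proof (cases "y \<in> C \<and> z \<notin> C")
      case True
      then have "{y, z} \<in> boundary G C" using edge_in_boundary_iff[OF assms(1) yz(1)] by simp
      then show ?thesis using yz(2) by blast
    qed (use step in auto)
  qed simp
  then show ?thesis using xy by simp
qed

text \<open>If \<open>D\<close> contained all end points of \<open>boundary G C\<close> or none of them, then \<open>D\<close> or its complement could not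
  meet both sides of \<open>C\<close>, as both are connected.\<close>

lemma finite_crossing:
  assumes "simple_graph G" "connected_graph G" "is_cut G C"
  shows "finite {D. is_k_cut G k D \<and> \<not> nested G C D}"
proof -
  let ?F = "\<Union> (boundary G C)"
  have FV: "?F \<subseteq> verts G" using assms(1) by (auto simp: boundary_def simple_graph_def doubleton_eq_iff)
  have "\<exists>u\<in>?F. \<exists>v\<in>?F. u \<in> D \<and> v \<notin> D" if D: "is_k_cut G k D" "\<not> nested G C D" for D
  proof -
    have CV: "C \<subseteq> verts G" "D \<subseteq> verts G" using assms(3) D(1) by (auto simp: is_cut_def is_k_cut_def)
    have "D \<inter> C \<noteq> {}" "D - C \<noteq> {}" "compl_in G D \<inter> C \<noteq> {}" "compl_in G D - C \<noteq> {}"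
      using D(2) CV unfolding nested_def by auto
    moreover have "connected_graph (induced G D)" "connected_graph (induced G (compl_in G D))"
      using D(1) by (auto simp: is_cut_def is_k_cut_def)
    ultimately have "D \<inter> ?F \<noteq> {}" "compl_in G D \<inter> ?F \<noteq> {}"
      using CV(2) by (simp_all add: connected_set_meets_boundary[OF assms(1)] del: Diff_eq_empty_iff)
    then show ?thesis by blast
  qed
  then have sub: "{D. is_k_cut G k D \<and> \<not> nested G C D}
    \<subseteq> (\<Union>u\<in>?F. \<Union>v\<in>?F. {D. is_k_cut G k D \<and> u \<in> D \<and> v \<notin> D})"
    by fast
  have fin: "finite {D. is_k_cut G k D \<and> u \<in> D \<and> v \<notin> D}" if "v \<in> ?F" for u v
    using finite_k_cuts_separating[OF assms(1,2)] FV that by blast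
  have "finite ?F" using assms by (intro finite_Union_boundary) (auto simp: is_cut_def)
  then have "finite (\<Union>u\<in>?F. \<Union>v\<in>?F. {D. is_k_cut G k D \<and> u \<in> D \<and> v \<notin> D})"
    using fin by (intro finite_UN_I)
  with sub show ?thesis by (rule finite_subset)
qed


section \<open>Crossing numbers of corners\<close>

lemma nested_sym:
  assumes "C \<subseteq> verts G" "D \<subseteq> verts G"
  shows "nested G C D \<longleftrightarrow> nested G D C"
  using assms unfolding nested_def by blast

lemma nested_compl_left:
  assumes "C \<subseteq> verts G"
  shows "nested G (compl_in G C) D \<longleftrightarrow> nested G C D"
  using assms unfolding nested_def by (auto simp: double_diff)

lemma nested_compl_right:
  assumes "D \<subseteq> verts G"
  shows "nested G C (compl_in G D) \<longleftrightarrow> nested G C D"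
  using assms unfolding nested_def by (auto simp: double_diff)

text \<open>If \<open>C\<close> or \<open>D\<close> lies on one side of \<open>F\<close>, so does
  \<open>C \<inter> D\<close>; if both complements lie on the same side of \<open>F\<close>, so does
  their union. If they lie on opposite sides, they are disjoint, which is impossible for crossing
  \<open>C\<close> and \<open>D\<close>.\<close>

lemma nested_corner:
  assumes "C \<subseteq> verts G" "D \<subseteq> verts G" "F \<subseteq> verts G"
    and "\<not> nested G C D" "nested G C F" "nested G D F"
  shows "nested G (C \<inter> D) F"
proof -
  have ne: "C \<inter> D \<noteq> {}" "\<not> compl_in G C \<subseteq> D" using assms(1,4) by (auto simp: nested_def)
  from assms(5) consider "C \<subseteq> F" | "C \<subseteq> compl_in G F" | "compl_in G C \<subseteq> F" | "compl_in G C \<subseteq> compl_in G F"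
    by (auto simp: nested_def)
  note 1 = this
  from assms(6) consider "D \<subseteq> F" | "D \<subseteq> compl_in G F" | "compl_in G D \<subseteq> F" | "compl_in G D \<subseteq> compl_in G F"
    by (auto simp: nested_def)
  note 2 = this
  show ?thesis
    by (cases rule: 1; cases rule: 2) (use ne assms(1-3) in \<open>unfold nested_def, blast+\<close>)
qed

text \<open>An inclusion of \<open>C\<close> passes to the first corner, one of
  \<open>compl_in G C\<close> to the second. Hence a set crossing both corners crosses
  \<open>C\<close> and, by symmetry, \<open>D\<close>.\<close>

lemma nested_some_corner:
  assumes "C \<subseteq> verts G" "F \<subseteq> verts G" "nested G C F"
  shows "nested G (C \<inter> D) F \<or> nested G (compl_in G C \<inter> compl_in G D) F"
  using assms unfolding nested_def by blast

text \<open>The counterpart of submodularity for crossing numbers: a cut crossing one corner crosses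
  \<open>C\<close> or \<open>D\<close>, a cut crossing both corners crosses both. It is the strict
  inequality that later contradicts optimality.\<close>

lemma num_crossing_corners:
  assumes G: "simple_graph G" "connected_graph G"
    and C: "is_k_cut G k C" and D: "is_k_cut G k D" and nn: "\<not> nested G C D"
  shows "num_crossing G k (C \<inter> D) + num_crossing G k (compl_in G C \<inter> compl_in G D)
    < num_crossing G k C + num_crossing G k D"
proof -
  define X where "X A = {F. is_k_cut G k F \<and> \<not> nested G A F}" for A
  have V: "C \<subseteq> verts G" "D \<subseteq> verts G" using C D by (auto simp: is_k_cut_def is_cut_def)
  have VF: "F \<subseteq> verts G" if "is_k_cut G k F" for F using that by (auto simp: is_k_cut_def is_cut_def)
  let ?E = "C \<inter> D" and ?E' = "compl_in G C \<inter> compl_in G D"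
  have fin: "finite (X C)" "finite (X D)"
    using C D finite_crossing[OF G] by (auto simp: X_def is_k_cut_def)
  have nn': "\<not> nested G (compl_in G C) (compl_in G D)"
    using nn V by (simp add: nested_compl_left nested_compl_right)
  have Un: "X ?E \<union> X ?E' \<subseteq> X C \<union> X D"
  proof
    fix F assume "F \<in> X ?E \<union> X ?E'"
    then show "F \<in> X C \<union> X D"
      using nested_corner[OF V VF nn] nested_corner[OF _ _ VF nn', of F] V
      by (auto simp: X_def nested_compl_left)
  qed
  have Int: "X ?E \<inter> X ?E' \<subseteq> X C \<inter> X D"
  proof
    fix F assume "F \<in> X ?E \<inter> X ?E'"
    then show "F \<in> X C \<inter> X D"
      using nested_some_corner[OF V(1) VF, of F D] nested_some_corner[OF V(2) VF, of F C]
      by (auto simp: X_def Int_commute)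
  qed
  \<comment> \<open>Strictness: \<open>C\<close> itself is counted among the cuts crossing
    \<open>D\<close>, but it is nested with both corners.\<close>
  have "C \<notin> X ?E \<union> X ?E'" "C \<in> X D"
    using C nn V nested_sym[of C G D] unfolding X_def nested_def by blast+
  then have "X ?E \<union> X ?E' \<subset> X C \<union> X D" using Un by blast
  then have lt: "card (X ?E \<union> X ?E') < card (X C \<union> X D)"
    using fin by (simp add: psubset_card_mono)
  have finE: "finite (X ?E)" "finite (X ?E')" using Un fin by (meson finite_UnI finite_subset le_sup_iff)+
  have "card (X ?E) + card (X ?E') = card (X ?E \<union> X ?E') + card (X ?E \<inter> X ?E')"
    by (rule card_Un_Int[OF finE])
  also have "\<dots> < card (X C \<union> X D) + card (X C \<inter> X D)"
    using lt card_mono[OF _ Int] fin by (simp add: add_less_le_mono)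
  also have "\<dots> = card (X C) + card (X D)" using card_Un_Int[OF fin] by simp
  finally show ?thesis by (simp add: num_crossing_def X_def)
qed

lemma num_crossing_compl:
  "C \<subseteq> verts G \<Longrightarrow> num_crossing G k (compl_in G C) = num_crossing G k C"
  by (simp add: num_crossing_def nested_compl_left)


section \<open>Rays and separation\<close>

definition ray :: "'a ugraph \<Rightarrow> (nat \<Rightarrow> 'a) \<Rightarrow> bool" where
  "ray G r \<longleftrightarrow> inj r \<and> (\<forall>n. (r n, r (Suc n)) \<in> adj G)"

definition tail_in :: "(nat \<Rightarrow> 'a) \<Rightarrow> 'a set \<Rightarrow> bool" where
  "tail_in r S \<longleftrightarrow> (\<forall>\<^sub>F n in sequentially. r n \<in> S)"

definition fwd :: "(int \<Rightarrow> 'a) \<Rightarrow> nat \<Rightarrow> 'a" where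
  "fwd \<alpha> n = \<alpha> (int n)"

definition bwd :: "(int \<Rightarrow> 'a) \<Rightarrow> nat \<Rightarrow> 'a" where
  "bwd \<alpha> n = \<alpha> (- int n)"

text \<open>For \<open>S\<close> with finite boundary this agrees with the two infinite
  intersections in \<open>path_cuts\<close>, see \<open>separates_iff_infinite\<close>. Phrased by
  tails, arguments about corners become propositional.\<close>

definition separates :: "'a set \<Rightarrow> (int \<Rightarrow> 'a) \<Rightarrow> bool" where
  "separates S \<alpha> \<longleftrightarrow> tail_in (fwd \<alpha>) S \<noteq> tail_in (bwd \<alpha>) S"

lemma tail_in_Int: "tail_in r (S \<inter> T) \<longleftrightarrow> tail_in r S \<and> tail_in r T"
  by (simp add: tail_in_def eventually_conj_iff)

lemma tail_in_mono: "tail_in r S \<Longrightarrow> S \<subseteq> T \<Longrightarrow> tail_in r T"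
  unfolding tail_in_def by (auto elim: eventually_mono)

lemma tail_in_nonempty: "tail_in r S \<Longrightarrow> S \<noteq> {}"
  by (auto simp: tail_in_def)

lemma tail_in_iff: "tail_in r S \<longleftrightarrow> (\<exists>N. \<forall>n\<ge>N. r n \<in> S)"
  by (simp add: tail_in_def eventually_sequentially)

lemma ray_verts: "ray G r \<Longrightarrow> r n \<in> verts G"
  using adj_verts unfolding ray_def by fast

lemma ray_fwd_bwd:
  assumes "biinfinite_path G \<alpha>"
  shows "ray G (fwd \<alpha>)" "ray G (bwd \<alpha>)"
proof -
  have \<alpha>: "inj \<alpha>" "range \<alpha> \<subseteq> verts G" "\<And>i. {\<alpha> i, \<alpha> (i + 1)} \<in> edges G"
    using assms by (auto simp: biinfinite_path_def)
  have step: "(\<alpha> i, \<alpha> (i + 1)) \<in> adj G" for i using \<alpha> by (auto simp: adj_def)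
  have "(fwd \<alpha> n, fwd \<alpha> (Suc n)) \<in> adj G" for n
    using step[of "int n"] by (simp add: fwd_def add.commute)
  moreover have "(bwd \<alpha> n, bwd \<alpha> (Suc n)) \<in> adj G" for n
    using step[of "- int (Suc n)"] sym_adj[of G] by (auto simp: bwd_def dest: symD)
  moreover have "inj (fwd \<alpha>)" "inj (bwd \<alpha>)"
    by (auto simp: fwd_def bwd_def inj_eq[OF \<alpha>(1)] intro!: injI)
  ultimately show "ray G (fwd \<alpha>)" "ray G (bwd \<alpha>)" by (auto simp: ray_def)
qed

lemma range_fwd_bwd: "range \<alpha> = range (fwd \<alpha>) \<union> range (bwd \<alpha>)"
proof -
  have "\<alpha> i \<in> range (fwd \<alpha>) \<union> range (bwd \<alpha>)" for i
    by (cases i rule: int_cases2) (auto simp: fwd_def bwd_def)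
  then show ?thesis by (auto simp: fwd_def bwd_def)
qed

lemma infinite_if_tail_in:
  assumes "inj r" "tail_in r S"
  shows "infinite (range r \<inter> S)"
proof -
  obtain N where N: "\<And>n. n \<ge> N \<Longrightarrow> r n \<in> S" using assms(2) by (auto simp: tail_in_iff)
  have "infinite (r ` {N..})"
    using finite_imageD[of r "{N..}"] inj_on_subset[OF assms(1)] infinite_Ici by blast
  moreover have "r ` {N..} \<subseteq> range r \<inter> S" using N by auto
  ultimately show ?thesis using finite_subset by blast
qed

lemma finite_if_tail_in_compl:
  assumes "tail_in r S" "S \<inter> T = {}"
  shows "finite (range r \<inter> T)"
proof -
  obtain N where N: "\<And>n. n \<ge> N \<Longrightarrow> r n \<in> S" using assms(1) by (auto simp: tail_in_iff)
  have "range r \<inter> T \<subseteq> r ` {..<N}"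
  proof
    fix x assume "x \<in> range r \<inter> T"
    then obtain n where n: "x = r n" "r n \<in> T" by blast
    then have "\<not> n \<ge> N" using N assms(2) by blast
    then show "x \<in> r ` {..<N}" using n by simp
  qed
  then show ?thesis by (rule finite_subset) simp
qed

lemma tail_avoids_finite:
  assumes "inj r" "finite F" "tail_in r S"
  shows "tail_in r (S - F)"
proof -
  have "finite {n. r n \<in> F}" using assms(1,2) by (simp add: finite_vimageI flip: vimage_def)
  then obtain N where "\<And>n. r n \<in> F \<Longrightarrow> n < N" using finite_nat_set_iff_bounded by auto
  moreover obtain M where "\<And>n. n \<ge> M \<Longrightarrow> r n \<in> S" using assms(3) by (auto simp: tail_in_iff)
  ultimately have "\<forall>n \<ge> max M N. r n \<in> S - F" by (metis Diff_iff leD max.bounded_iff)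
  then show ?thesis unfolding tail_in_iff by blast
qed

text \<open>An injective ray uses each edge at most once, so it crosses a finite boundary finitely
  often and finally stays on one side.\<close>

lemma ray_tail_dichotomy:
  assumes "simple_graph G" "ray G r" "finite (boundary G S)"
  shows "tail_in r (compl_in G S) \<longleftrightarrow> \<not> tail_in r S"
proof -
  have r: "inj r" "\<And>n. (r n, r (Suc n)) \<in> adj G" using assms(2) by (auto simp: ray_def)
  have "inj (\<lambda>n. {r n, r (Suc n)})"
    by (auto simp: doubleton_eq_iff inj_eq[OF r(1)] intro!: injI)
  then have "finite {n. {r n, r (Suc n)} \<in> boundary G S}"
    using finite_vimageI[OF assms(3)] by (simp add: vimage_def)
  then obtain N where N: "\<And>n. {r n, r (Suc n)} \<in> boundary G S \<Longrightarrow> n < N"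
    using finite_nat_set_iff_bounded by auto
  have step: "r (Suc n) \<in> S \<longleftrightarrow> r n \<in> S" if "n \<ge> N" for n
    using N[of n] that edge_in_boundary_iff[OF assms(1), of "r n" "r (Suc n)" S] r(2)[of n]
    by (auto simp: adj_def)
  have const: "r n \<in> S \<longleftrightarrow> r N \<in> S" if "n \<ge> N" for n
    using that by (induction rule: dec_induct) (simp_all add: step)
  show ?thesis
  proof (cases "r N \<in> S")
    case True
    then have "tail_in r S" unfolding tail_in_iff using const by blast
    moreover have "\<not> tail_in r (compl_in G S)"
      using \<open>tail_in r S\<close> tail_in_nonempty[of r "S \<inter> compl_in G S"] unfolding tail_in_Int by blast
    ultimately show ?thesis by simp
  next
    case False
    then have "tail_in r (compl_in G S)"
      unfolding tail_in_iff using const ray_verts[OF assms(2)] by blast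
    moreover have "\<not> tail_in r S"
      using \<open>tail_in r (compl_in G S)\<close> tail_in_nonempty[of r "S \<inter> compl_in G S"]
      unfolding tail_in_Int by blast
    ultimately show ?thesis by simp
  qed
qed

lemma separates_iff_infinite:
  assumes "simple_graph G" "biinfinite_path G \<alpha>" "finite (boundary G S)"
  shows "separates S \<alpha> \<longleftrightarrow> infinite (range \<alpha> \<inter> S) \<and> infinite (range \<alpha> \<inter> compl_in G S)"
proof -
  note rays = ray_fwd_bwd[OF assms(2)]
  then have inj: "inj (fwd \<alpha>)" "inj (bwd \<alpha>)" by (auto simp: ray_def)
  have inf: "infinite (range r \<inter> S) \<longleftrightarrow> tail_in r S"
    "infinite (range r \<inter> compl_in G S) \<longleftrightarrow> \<not> tail_in r S" if "ray G r" for r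
    using ray_tail_dichotomy[OF assms(1) that assms(3)] infinite_if_tail_in[of r]
      finite_if_tail_in_compl[of r S "compl_in G S"] finite_if_tail_in_compl[of r "compl_in G S" S]
      that
    by (auto simp: ray_def)
  show ?thesis
    using inf[OF rays(1)] inf[OF rays(2)]
    by (auto simp: separates_def range_fwd_bwd[of \<alpha>] Int_Un_distrib2)
qed

lemma path_cuts_iff:
  assumes "simple_graph G" "biinfinite_path G \<alpha>"
  shows "C \<in> path_cuts G \<alpha> \<longleftrightarrow> is_cut G C \<and> separates C \<alpha>"
  using separates_iff_infinite[OF assms, of C] by (auto simp: path_cuts_def is_cut_def)

section \<open>Components of vertex sets and the cuts obtained from them\<close>

definition component :: "'a ugraph \<Rightarrow> 'a set \<Rightarrow> 'a \<Rightarrow> 'a set" where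
  "component G S x = {z. (x, z) \<in> (adj G \<inter> S \<times> S)\<^sup>*}"

lemma self_in_component: "x \<in> component G S x"
  by (simp add: component_def)

lemma component_subset: "x \<in> S \<Longrightarrow> component G S x \<subseteq> S"
  by (auto simp: component_def elim: rtranclE)

lemma component_closed:
  assumes "y \<in> component G S x" "(y, z) \<in> adj G" "y \<in> S" "z \<in> S"
  shows "z \<in> component G S x"
  using assms by (auto simp: component_def intro: rtrancl_into_rtrancl)

lemma component_reachable:
  assumes "z \<in> component G S x"
  shows "(x, z) \<in> (adj G \<inter> component G S x \<times> component G S x)\<^sup>*" (is "_ \<in> ?R\<^sup>*")
proof -
  have "(x, z) \<in> (adj G \<inter> S \<times> S)\<^sup>*" using assms by (simp add: component_def)
  then show ?thesis
  proof (induction rule: rtrancl_induct)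
    case (step y z)
    then have "y \<in> component G S x" "z \<in> component G S x"
      by (auto simp: component_def intro: rtrancl_into_rtrancl)
    with step have "(y, z) \<in> ?R" by blast
    with step.IH show ?case by (rule rtrancl_into_rtrancl)
  qed simp
qed

lemma component_connected: "connected_graph (induced G (component G S x))"
  by (rule connected_induced_if_reachable[OF component_reachable])

text \<open>An edge that leaves the component without leaving \<open>S\<close> would extend the
  component.\<close>

lemma boundary_component:
  assumes "simple_graph G" "x \<in> S"
  shows "boundary G (component G S x) \<subseteq> boundary G S"
  using component_subset[OF assms(2), of G] component_closed[of _ G S x]
  by (intro boundary_subsetI[OF assms(1)]) blast

lemma ray_tail_in_component:
  assumes "ray G r" "\<And>n. n \<ge> N \<Longrightarrow> r n \<in> S"
  shows "tail_in r (component G S (r N))"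
proof -
  have "r n \<in> component G S (r N)" if "n \<ge> N" for n
    using that
  proof (induction rule: dec_induct)
    case base then show ?case by (rule self_in_component)
  next
    case (step n)
    have "(r n, r (Suc n)) \<in> adj G" using assms(1) by (simp add: ray_def)
    then show ?case using component_closed[OF step.IH] assms(2) step.hyps by simp
  qed
  then show ?thesis unfolding tail_in_iff by blast
qed

text \<open>What remains is \<open>P\<close> together with the other components of
  \<open>compl_in G P\<close>. A walk in \<open>G\<close> towards \<open>x\<close> cannot pass from
  one of these into the removed component before meeting \<open>P\<close>, and from there it can be
  continued inside \<open>P\<close>.\<close>

lemma component_compl_connected:
  assumes "connected_graph G" "P \<subseteq> verts G" "x \<in> P" "y \<in> compl_in G P"
    and P: "\<And>z. z \<in> P \<Longrightarrow> (z, x) \<in> (adj G \<inter> P \<times> P)\<^sup>*"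
  shows "connected_graph (induced G (compl_in G (component G (compl_in G P) y)))"
proof -
  define Q where "Q = compl_in G (component G (compl_in G P) y)"
  have PQ: "P \<subseteq> Q" using component_subset[OF assms(4), of G] assms(2) by (auto simp: Q_def)
  then have mono: "(adj G \<inter> P \<times> P)\<^sup>* \<subseteq> (adj G \<inter> Q \<times> Q)\<^sup>*" by (intro rtrancl_mono) auto
  have reach: "(z, x) \<in> (adj G \<inter> Q \<times> Q)\<^sup>*" if "(z, x) \<in> (adj G)\<^sup>*" "z \<in> Q" for z
    using that
  proof (induction rule: converse_rtrancl_induct)
    case (step z z')
    show ?case
    proof (cases "z \<in> P")
      case True then show ?thesis using P mono by blast
    next
      case False
      have "z' \<in> Q"
      proof (rule ccontr)
        assume "z' \<notin> Q"
        then have z': "z' \<in> component G (compl_in G P) y"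
          using step(1) adj_verts[of z z' G] by (auto simp: Q_def)
        moreover have "(z', z) \<in> adj G" using step(1) sym_adj[of G] by (auto dest: symD)
        moreover have "z \<in> compl_in G P" using False adj_verts[OF step(1)] by simp
        moreover have "z' \<in> compl_in G P" using component_subset[OF assms(4), of G] z' by blast
        ultimately have "z \<in> component G (compl_in G P) y"
          by (simp add: component_closed)
        with step(4) show False by (simp add: Q_def)
      qed
      with step show ?thesis by (auto intro: converse_rtrancl_into_rtrancl)
    qed
  qed simp
  have "(x, z) \<in> (adj G \<inter> Q \<times> Q)\<^sup>*" if "z \<in> Q" for z
  proof -
    have "(z, x) \<in> (adj G)\<^sup>*" using that assms(1-3) by (auto simp: connected_graph_def Q_def)
    then show ?thesis using symD[OF sym_rtrancl_adj_within reach] that by blast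
  qed
  then show ?thesis unfolding Q_def[symmetric] by (rule connected_induced_if_reachable)
qed

text \<open>Pass to the component of \<open>S\<close> containing the first tail, then to the component of the
  complement containing the second one: both steps only shrink the boundary.\<close>

lemma exists_cut_below_separating_set:
  assumes G: "simple_graph G" "connected_graph G"
    and S: "S \<subseteq> verts G" "finite (boundary G S)"
    and r: "ray G r" "tail_in r S" and s: "ray G s" "tail_in s (compl_in G S)"
  shows "\<exists>Q. is_cut G Q \<and> boundary G Q \<subseteq> boundary G S \<and> tail_in r Q \<and> tail_in s (compl_in G Q)"
proof -
  obtain N where N: "\<And>n. n \<ge> N \<Longrightarrow> r n \<in> S" using r(2) by (auto simp: tail_in_iff)
  define P where "P = component G S (r N)"
  have PS: "P \<subseteq> S" using component_subset[of "r N" S G] N by (simp add: P_def)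
  then have "tail_in s (compl_in G P)" using tail_in_mono[OF s(2)] by blast
  then obtain M where M: "\<And>n. n \<ge> M \<Longrightarrow> s n \<in> compl_in G P" by (auto simp: tail_in_iff)
  define Q' where "Q' = component G (compl_in G P) (s M)"
  have Q'P: "Q' \<subseteq> compl_in G P" using component_subset[of "s M" "compl_in G P" G] M by (simp add: Q'_def)
  define Q where "Q = compl_in G Q'"
  have compl: "compl_in G Q = Q'" using Q'P by (auto simp: Q_def)
  have tr: "tail_in r P" unfolding P_def by (rule ray_tail_in_component[OF r(1) N])
  have ts: "tail_in s Q'" unfolding Q'_def by (rule ray_tail_in_component[OF s(1) M])
  have "boundary G Q = boundary G Q'" using boundary_compl[OF G(1), of Q'] by (simp add: Q_def)
  also have "\<dots> \<subseteq> boundary G P"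
    using boundary_component[OF G(1) M[of M]] boundary_compl[OF G(1), of P] by (simp add: Q'_def)
  also have "\<dots> \<subseteq> boundary G S"
    using boundary_component[OF G(1) N[of N]] by (simp add: P_def)
  finally have bd: "boundary G Q \<subseteq> boundary G S" .
  have "connected_graph (induced G Q)"
    unfolding Q_def Q'_def
  proof (rule component_compl_connected[OF G(2)])
    show "P \<subseteq> verts G" using PS S by blast
    show "r N \<in> P" by (simp add: P_def self_in_component)
    show "s M \<in> compl_in G P" using M by simp
    show "(z, r N) \<in> (adj G \<inter> P \<times> P)\<^sup>*" if "z \<in> P" for z
      using component_reachable[of z G S "r N"] that sym_rtrancl_adj_within[of G P]
      by (auto simp: P_def dest: symD)
  qed
  moreover have "connected_graph (induced G Q')"
    unfolding Q'_def by (rule component_connected)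
  moreover have "P \<subseteq> Q" using PS S Q'P by (auto simp: Q_def)
  then have tQ: "tail_in r Q" using tr tail_in_mono by blast
  moreover have "finite (boundary G Q)" using bd S finite_subset by blast
  ultimately have "is_cut G Q"
    using tail_in_nonempty[OF ts] tail_in_nonempty[OF tQ] compl
    by (simp add: is_cut_def) (simp add: Q_def)
  then show ?thesis using bd tQ ts compl by auto
qed

text \<open>Lets minimality over \<open>path_cuts\<close> be tested against separating sets whose
  sides may be disconnected, such as corners of two cuts.\<close>

lemma exists_path_cut_below:
  assumes G: "simple_graph G" "connected_graph G" and \<alpha>: "biinfinite_path G \<alpha>"
    and S: "S \<subseteq> verts G" "finite (boundary G S)" "separates S \<alpha>"
  shows "\<exists>Q \<in> path_cuts G \<alpha>. boundary G Q \<subseteq> boundary G S"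
proof -
  note rays = ray_fwd_bwd[OF \<alpha>]
  have S': "tail_in r (compl_in G S) \<longleftrightarrow> \<not> tail_in r S" if "ray G r" for r
    using ray_tail_dichotomy[OF G(1) that S(2)] .
  have sep: "separates Q \<alpha>" if "is_cut G Q" 
    "tail_in (fwd \<alpha>) Q \<and> tail_in (bwd \<alpha>) (compl_in G Q) \<or> tail_in (bwd \<alpha>) Q \<and> tail_in (fwd \<alpha>) (compl_in G Q)" for Q
    using that ray_tail_dichotomy[OF G(1) rays(1), of Q] ray_tail_dichotomy[OF G(1) rays(2), of Q]
    by (auto simp: separates_def is_cut_def)
  from S(3) consider "tail_in (fwd \<alpha>) S" "tail_in (bwd \<alpha>) (compl_in G S)"
    | "tail_in (bwd \<alpha>) S" "tail_in (fwd \<alpha>) (compl_in G S)"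
    using S' rays by (auto simp: separates_def)
  then show ?thesis
  proof cases
    case 1
    from exists_cut_below_separating_set[OF G S(1,2) rays(1) 1(1) rays(2) 1(2)] sep
    show ?thesis by (auto simp: path_cuts_iff[OF G(1) \<alpha>])
  next
    case 2
    from exists_cut_below_separating_set[OF G S(1,2) rays(2) 2(1) rays(1) 2(2)] sep
    show ?thesis by (auto simp: path_cuts_iff[OF G(1) \<alpha>])
  qed
qed

text \<open>Membership in \<open>S\<close> and membership in \<open>T\<close> change along the same
  edges, so whether they agree is constant along walks.\<close>

lemma boundary_eqD:
  assumes G: "simple_graph G" "connected_graph G" and "S \<subseteq> verts G" "T \<subseteq> verts G"
    and bd: "boundary G S = boundary G T"
  shows "S = T \<or> S = compl_in G T"
proof (cases "verts G = {}")
  case False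
  then obtain x where x: "x \<in> verts G" by blast
  have "(z \<in> S \<longleftrightarrow> z \<in> T) \<longleftrightarrow> (x \<in> S \<longleftrightarrow> x \<in> T)" if "z \<in> verts G" for z
  proof -
    have "(x, z) \<in> (adj G)\<^sup>*" using x that G(2) by (auto simp: connected_graph_def)
    then show ?thesis
    proof (induction rule: rtrancl_induct)
      case (step y z)
      then have "{y, z} \<in> edges G" by (simp add: adj_def)
      from edge_in_boundary_iff[OF G(1) this, of S] edge_in_boundary_iff[OF G(1) this, of T] bd step(3)
      show ?case by auto
    qed simp
  qed
  then show ?thesis using assms(3,4) by blast
qed (use assms in auto)

lemma card_min_cut_le:
  assumes G: "simple_graph G" "connected_graph G" and \<alpha>: "biinfinite_path G \<alpha>"
    and S: "S \<subseteq> verts G" "finite (boundary G S)" "separates S \<alpha>"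
    and C: "C \<in> min_cuts G \<alpha>"
  shows "card (boundary G C) \<le> card (boundary G S)"
proof -
  obtain Q where Q: "Q \<in> path_cuts G \<alpha>" "boundary G Q \<subseteq> boundary G S"
    using exists_path_cut_below[OF G \<alpha> S] by blast
  then have "card (boundary G C) \<le> card (boundary G Q)" using C by (auto simp: min_cuts_def)
  also have "\<dots> \<le> card (boundary G S)" using Q(2) S(2) by (rule card_mono[rotated])
  finally show ?thesis .
qed

text \<open>Supplies the connectedness of both sides of \<open>S\<close>: a cut \<open>Q\<close>
  below \<open>S\<close> has no fewer boundary edges than \<open>S\<close>, so the boundaries
  coincide and \<open>S\<close> is \<open>Q\<close> or its complement.\<close>

lemma min_cut_if_separating:
  assumes G: "simple_graph G" "connected_graph G" and \<alpha>: "biinfinite_path G \<alpha>"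
    and S: "S \<subseteq> verts G" "finite (boundary G S)" "separates S \<alpha>"
    and C: "C \<in> min_cuts G \<alpha>" and le: "card (boundary G S) \<le> card (boundary G C)"
  shows "S \<in> min_cuts G \<alpha>"
proof -
  obtain Q where Q: "Q \<in> path_cuts G \<alpha>" "boundary G Q \<subseteq> boundary G S"
    using exists_path_cut_below[OF G \<alpha> S] by blast
  then have "card (boundary G C) \<le> card (boundary G Q)" using C by (auto simp: min_cuts_def)
  then have "card (boundary G S) \<le> card (boundary G Q)" using le by simp
  then have "boundary G Q = boundary G S" using Q(2) S(2) by (simp add: card_seteq)
  moreover have cQ: "is_cut G Q" using Q(1) by (simp add: path_cuts_def)
  ultimately have "S = Q \<or> S = compl_in G Q"
    using boundary_eqD[OF G S(1), of Q] by (auto simp: is_cut_def)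
  then have "is_cut G S" using cQ is_cut_compl[OF G(1)] by blast
  then have "S \<in> path_cuts G \<alpha>" using S(3) path_cuts_iff[OF G(1) \<alpha>] by simp
  then show ?thesis using C le by (auto simp: min_cuts_def intro: order_trans)
qed


section \<open>Optimal cuts are nested\<close>

text \<open>A given minimal cut shows that \<open>LEAST\<close> ranges over a nonempty set, so the
  numerical minimum can be replaced by pairwise comparisons.\<close>

lemma path_opt_cuts_iff:
  "C \<in> path_opt_cuts G k \<alpha> \<longleftrightarrow>
    C \<in> min_cuts G \<alpha> \<and> (\<forall>D \<in> min_cuts G \<alpha>. num_crossing G k C \<le> num_crossing G k D)"
proof (cases "C \<in> min_cuts G \<alpha>")
  case True
  have "min_crossing G k \<alpha> \<in> num_crossing G k ` min_cuts G \<alpha>"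
    unfolding min_crossing_def by (rule LeastI) (rule imageI[OF True])
  moreover have "min_crossing G k \<alpha> \<le> num_crossing G k D" if "D \<in> min_cuts G \<alpha>" for D
    unfolding min_crossing_def by (rule Least_le) (use that in blast)
  ultimately show ?thesis using True unfolding path_opt_cuts_def by fastforce
qed (simp add: path_opt_cuts_def)

lemma path_opt_cuts_nonempty:
  assumes "path_cuts G \<alpha> \<noteq> {}"
  shows "path_opt_cuts G k \<alpha> \<noteq> {}"
proof -
  obtain C where "C \<in> path_cuts G \<alpha>" 
    "\<And>D. D \<in> path_cuts G \<alpha> \<Longrightarrow> card (boundary G C) \<le> card (boundary G D)"
    using assms ex_has_least_nat[of "\<lambda>C. C \<in> path_cuts G \<alpha>" _ "\<lambda>C. card (boundary G C)"] by blast
  then have "C \<in> min_cuts G \<alpha>" by (simp add: min_cuts_def)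
  then obtain D where "D \<in> min_cuts G \<alpha>" 
    "\<And>E. E \<in> min_cuts G \<alpha> \<Longrightarrow> num_crossing G k D \<le> num_crossing G k E"
    using ex_has_least_nat[of "\<lambda>C. C \<in> min_cuts G \<alpha>" C "num_crossing G k"] by blast
  then show ?thesis using path_opt_cuts_iff by blast
qed

lemma path_opt_cuts_compl:
  assumes G: "simple_graph G" and C: "C \<in> path_opt_cuts G k \<alpha>"
  shows "compl_in G C \<in> path_opt_cuts G k \<alpha>"
proof -
  have CV: "C \<subseteq> verts G" using C by (auto simp: path_opt_cuts_iff min_cuts_def path_cuts_def is_cut_def)
  then have "compl_in G (compl_in G C) = C" by blast
  then show ?thesis using C is_cut_compl[OF G]
    by (simp add: path_opt_cuts_iff min_cuts_def path_cuts_def boundary_compl[OF G] num_crossing_compl[OF CV])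
qed

lemma min_cut_is_k_cut:
  assumes "accessible_with G k" "biinfinite_path G \<alpha>" "C \<in> min_cuts G \<alpha>"
  shows "is_k_cut G k C"
proof -
  have "C \<in> path_cuts G \<alpha>" using assms(3) by (simp add: min_cuts_def)
  then obtain D where D: "D \<in> path_cuts G \<alpha>" "is_k_cut G k D"
    using assms(1,2) unfolding accessible_with_def by blast
  then have "card (boundary G C) \<le> card (boundary G D)" using assms(3) by (simp add: min_cuts_def)
  then show ?thesis using D(2) \<open>C \<in> path_cuts G \<alpha>\<close> by (simp add: is_k_cut_def path_cuts_def)
qed

context
  fixes G :: "'a ugraph" and k :: nat
  assumes G: "simple_graph G" "connected_graph G" and acc: "accessible_with G k"
begin

lemma opt_cut_is_k_cut: "C \<in> opt_cuts G k \<Longrightarrow> is_k_cut G k C"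
  using min_cut_is_k_cut[OF acc] by (auto simp: opt_cuts_def path_opt_cuts_def)

lemma opt_cut_is_cut: "C \<in> opt_cuts G k \<Longrightarrow> is_cut G C"
  using opt_cut_is_k_cut by (auto simp: is_k_cut_def)

lemma opt_cut_verts: "C \<in> opt_cuts G k \<Longrightarrow> C \<subseteq> verts G"
  using opt_cut_is_cut by (auto simp: is_cut_def)

lemma opt_cut_compl: "C \<in> opt_cuts G k \<Longrightarrow> compl_in G C \<in> opt_cuts G k"
  using path_opt_cuts_compl[OF G(1)] by (auto simp: opt_cuts_def)

text \<open>By submodularity both corners are again minimal cuts, for \<open>\<alpha>\<close> and \<open>\<beta>\<close> respectively, and
  together they cross fewer \<open>k\<close>-cuts than \<open>C\<close> and \<open>D\<close> do.\<close>

lemma nested_if_opposite_corners_separate: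
  assumes \<alpha>: "biinfinite_path G \<alpha>" and \<beta>: "biinfinite_path G \<beta>"
    and C: "C \<in> path_opt_cuts G k \<alpha>" and D: "D \<in> path_opt_cuts G k \<beta>"
    and sep: "separates (C \<inter> D) \<alpha>" "separates (compl_in G C \<inter> compl_in G D) \<beta>"
  shows "nested G C D"
proof (rule ccontr)
  assume nn: "\<not> nested G C D"
  have min: "C \<in> min_cuts G \<alpha>" "D \<in> min_cuts G \<beta>" using C D by (auto simp: path_opt_cuts_def)
  have k: "is_k_cut G k C" "is_k_cut G k D" using min min_cut_is_k_cut[OF acc] \<alpha> \<beta> by auto
  then have fin: "finite (boundary G C)" "finite (boundary G D)" and V: "C \<subseteq> verts G"
    by (auto simp: is_k_cut_def is_cut_def)
  let ?E = "C \<inter> D" and ?E' = "compl_in G C \<inter> compl_in G D"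
  have finE: "finite (boundary G ?E)" "finite (boundary G ?E')"
    using fin by (auto intro!: finite_boundary_corner[OF G(1)] simp: boundary_compl[OF G(1)])
  have E: "?E \<subseteq> verts G" "?E' \<subseteq> verts G" using V by auto
  have le: "card (boundary G C) \<le> card (boundary G ?E)" "card (boundary G D) \<le> card (boundary G ?E')"
    using card_min_cut_le[OF G \<alpha> E(1) finE(1) sep(1) min(1)] 
      card_min_cut_le[OF G \<beta> E(2) finE(2) sep(2) min(2)] by auto
  \<comment> \<open>Each corner has at least as many boundary edges as its cut, while submodularity
    bounds the sum, so neither can have more.\<close>
  then have ge: "card (boundary G ?E) \<le> card (boundary G C)" "card (boundary G ?E') \<le> card (boundary G D)"
    using card_boundary_corners[OF G(1) fin] by linarith+
  have "?E \<in> min_cuts G \<alpha>" "?E' \<in> min_cuts G \<beta>"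
    using min_cut_if_separating[OF G \<alpha> E(1) finE(1) sep(1) min(1) ge(1)] 
      min_cut_if_separating[OF G \<beta> E(2) finE(2) sep(2) min(2) ge(2)] by auto
  then have "num_crossing G k C \<le> num_crossing G k ?E" "num_crossing G k D \<le> num_crossing G k ?E'"
    using C D by (auto simp: path_opt_cuts_iff)
  then show False using num_crossing_corners[OF G k nn] by linarith
qed

text \<open>Each cut competes for the path of the other, so boundary sizes and then crossing numbers
  compare in both directions and agree.\<close>

lemma path_opt_cuts_swap:
  assumes \<alpha>: "biinfinite_path G \<alpha>" and \<beta>: "biinfinite_path G \<beta>"
    and C: "C \<in> path_opt_cuts G k \<alpha>" and D: "D \<in> path_opt_cuts G k \<beta>"
    and sep: "separates C \<beta>" "separates D \<alpha>"
  shows "D \<in> path_opt_cuts G k \<alpha>"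
proof -
  have min: "C \<in> min_cuts G \<alpha>" "D \<in> min_cuts G \<beta>" using C D by (auto simp: path_opt_cuts_def)
  then have "is_cut G C" "is_cut G D" by (auto simp: min_cuts_def path_cuts_def)
  then have path: "C \<in> path_cuts G \<beta>" "D \<in> path_cuts G \<alpha>"
    using sep path_cuts_iff[OF G(1)] \<alpha> \<beta> by auto
  then have eq: "card (boundary G C) = card (boundary G D)"
    using min by (auto simp: min_cuts_def intro: antisym)
  then have min': "D \<in> min_cuts G \<alpha>" "C \<in> min_cuts G \<beta>"
    using min path by (auto simp: min_cuts_def)
  then have "num_crossing G k D = num_crossing G k C"
    using C D by (auto simp: path_opt_cuts_iff intro: antisym)
  then show ?thesis using C min' by (simp add: path_opt_cuts_iff)
qed

text \<open>If no two opposite corners separate \<open>\<alpha>\<close> and \<open>\<beta>\<close>, then the ends of \<open>\<alpha>\<close> and of \<open>\<beta>\<close> occupy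
  complementary pairs of opposite corners; in that case \<open>D\<close> is optimal for \<open>\<alpha>\<close> as well.\<close>

lemma opt_cuts_nested:
  assumes "C \<in> opt_cuts G k" "D \<in> opt_cuts G k"
  shows "nested G C D"
proof (rule ccontr)
  assume nn: "\<not> nested G C D"
  have V: "C \<subseteq> verts G" "D \<subseteq> verts G" using assms opt_cut_verts by auto
  then have cc: "compl_in G (compl_in G C) = C" "compl_in G (compl_in G D) = D" by auto
  have fin: "finite (boundary G C)" "finite (boundary G D)"
    using assms opt_cut_is_cut by (auto simp: is_cut_def)
  have corners: "\<not> (separates (C \<inter> D) \<alpha> \<and> separates (compl_in G C \<inter> compl_in G D) \<beta>)"
    "\<not> (separates (C \<inter> compl_in G D) \<alpha> \<and> separates (compl_in G C \<inter> D) \<beta>)"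
    "\<not> (separates (compl_in G C \<inter> D) \<alpha> \<and> separates (C \<inter> compl_in G D) \<beta>)"
    "\<not> (separates (compl_in G C \<inter> compl_in G D) \<alpha> \<and> separates (C \<inter> D) \<beta>)"
    if \<alpha>: "biinfinite_path G \<alpha>" and \<beta>: "biinfinite_path G \<beta>"
    and C: "C \<in> path_opt_cuts G k \<alpha>" and D: "D \<in> path_opt_cuts G k \<beta>" for \<alpha> \<beta>
  proof -
    note * = nested_if_opposite_corners_separate[OF \<alpha> \<beta>]
    \<comment> \<open>Complementing \<open>C\<close> or \<open>D\<close> permutes the corners, so
      one lemma rules out all four assignments of opposite corners.\<close>
    note C' = path_opt_cuts_compl[OF G(1) C] and D' = path_opt_cuts_compl[OF G(1) D]
    have nn': "\<not> nested G C (compl_in G D)" "\<not> nested G (compl_in G C) D" 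
      "\<not> nested G (compl_in G C) (compl_in G D)"
      using nn V by (auto simp: nested_compl_left nested_compl_right)
    show "\<not> (separates (C \<inter> D) \<alpha> \<and> separates (compl_in G C \<inter> compl_in G D) \<beta>)"
      "\<not> (separates (C \<inter> compl_in G D) \<alpha> \<and> separates (compl_in G C \<inter> D) \<beta>)"
      "\<not> (separates (compl_in G C \<inter> D) \<alpha> \<and> separates (C \<inter> compl_in G D) \<beta>)"
      "\<not> (separates (compl_in G C \<inter> compl_in G D) \<alpha> \<and> separates (C \<inter> D) \<beta>)"
      using *[OF C D] *[OF C D'] *[OF C' D] *[OF C' D'] nn nn' unfolding cc by blast+
  qed
  from assms obtain \<alpha> \<beta> where \<alpha>: "biinfinite_path G \<alpha>" and \<beta>: "biinfinite_path G \<beta>"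
    and C: "C \<in> path_opt_cuts G k \<alpha>" and D: "D \<in> path_opt_cuts G k \<beta>"
    by (auto simp: opt_cuts_def)
  have sepC: "separates C \<alpha>" and sepD: "separates D \<beta>"
    using C D path_cuts_iff[OF G(1)] \<alpha> \<beta> by (auto simp: path_opt_cuts_def min_cuts_def)
  have tails: "tail_in r (compl_in G C) \<longleftrightarrow> \<not> tail_in r C" "tail_in r (compl_in G D) \<longleftrightarrow> \<not> tail_in r D"
    if "ray G r" for r using ray_tail_dichotomy[OF G(1) that] fin by auto
  note tails = tails[OF ray_fwd_bwd(1)[OF \<alpha>]] tails[OF ray_fwd_bwd(2)[OF \<alpha>]]
    tails[OF ray_fwd_bwd(1)[OF \<beta>]] tails[OF ray_fwd_bwd(2)[OF \<beta>]]
  note corners' = corners[unfolded separates_def tail_in_Int]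
  \<comment> \<open>If \<open>D\<close> did not separate \<alpha>, the tails of \<alpha> would
    occupy both corners on one side of \<open>D\<close>, while one tail of \<beta> lies in a corner
    on the other side. Then \<beta> separates that corner and \<alpha> separates the opposite one,
    which is excluded. The argument for \<open>C\<close> and \<beta> is the same.\<close>
  have "separates C \<beta>" "separates D \<alpha>"
    using corners'[OF \<alpha> \<beta> C D] sepC sepD unfolding separates_def tails by argo+
  then have "D \<in> path_opt_cuts G k \<alpha>" using path_opt_cuts_swap[OF \<alpha> \<beta> C D] by simp
  \<comment> \<open>Both cuts separate \<alpha>, so its two tails lie in opposite corners; taking
    \<alpha> for both paths gives the contradiction.\<close>
  from corners'[OF \<alpha> \<alpha> C this] sepC \<open>separates D \<alpha>\<close>
  show False unfolding separates_def tails by argo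
qed

end


section \<open>Neighbourhoods\<close>

lemma relpow_adj_sym: "(u, v) \<in> adj G ^^ n \<Longrightarrow> (v, u) \<in> adj G ^^ n"
proof (induction n arbitrary: v)
  case (Suc n)
  then obtain y where "(u, y) \<in> adj G ^^ n" "(y, v) \<in> adj G" by auto
  then have "(v, y) \<in> adj G" "(y, u) \<in> adj G ^^ n" using Suc.IH sym_adj[of G] by (auto dest: symD)
  then show ?case by (rule relpow_Suc_I2)
qed simp

lemma relpow_segment:
  assumes "\<And>i. i < n \<Longrightarrow> (f i, f (Suc i)) \<in> R" "a \<le> b" "b \<le> n"
  shows "(f a, f b) \<in> R ^^ (b - a)"
  unfolding relpow_fun_conv
  by (rule exI[of _ "\<lambda>i. f (a + i)"]) (use assms in auto)

lemma mem_nbhd_iff: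
  "v \<in> nbhd G j S \<longleftrightarrow> v \<in> verts G \<and> (\<exists>s\<in>S. \<exists>n\<le>j. (v, s) \<in> adj G ^^ n)"
proof -
  \<comment> \<open>The strict form is needed because an infimum lies strictly below a bound exactly
    if some element does; this also covers the empty infimum.\<close>
  have "set_dist G v S \<le> enat j \<longleftrightarrow> set_dist G v S < enat (Suc j)" by (cases "set_dist G v S") auto
  also have "\<dots> \<longleftrightarrow> (\<exists>s\<in>S. \<exists>n\<le>j. (v, s) \<in> adj G ^^ n)"
    by (auto simp: set_dist_def graph_dist_def INF_less_iff less_Suc_eq_le)
  finally show ?thesis by (simp add: nbhd_def)
qed

lemma nbhd_verts: "nbhd G j S \<subseteq> verts G"
  by (auto simp: nbhd_def)

lemma subset_nbhd: "S \<subseteq> verts G \<Longrightarrow> S \<subseteq> nbhd G j S"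
proof
  fix v assume "S \<subseteq> verts G" "v \<in> S"
  then show "v \<in> nbhd G j S"
    unfolding mem_nbhd_iff by (auto intro!: bexI[of _ v] exI[of _ 0])
qed

lemma neighbour_in_nbhd:
  assumes "(x, w) \<in> adj G" "x \<in> S" "j \<ge> 1"
  shows "w \<in> nbhd G j S"
proof -
  have "(w, x) \<in> adj G ^^ 1" using assms(1) sym_adj[of G] by (auto dest: symD)
  then show ?thesis using assms adj_verts[OF assms(1)] unfolding mem_nbhd_iff by blast
qed

lemma finite_neighbours: "locally_finite G \<Longrightarrow> finite {u. (v, u) \<in> adj G}"
proof (cases "v \<in> verts G")
  case False
  then have empty: "{u. (v, u) \<in> adj G} = {}" by (auto simp: adj_def)
  show ?thesis unfolding empty by simp
qed (simp add: locally_finite_def)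

lemma finite_sphere: "locally_finite G \<Longrightarrow> finite {u. (v, u) \<in> adj G ^^ n}"
proof (induction n)
  case (Suc n)
  have "{u. (v, u) \<in> adj G ^^ Suc n} = (\<Union>y\<in>{y. (v, y) \<in> adj G ^^ n}. {u. (y, u) \<in> adj G})"
    by auto
  then show ?case using Suc finite_neighbours by auto
qed simp

text \<open>A walk of length at most \<open>j\<close> from outside \<open>D\<close> into
  \<open>D\<close> crosses the boundary, so its start lies in a ball of radius \<open>j\<close>
  around one of finitely many boundary vertices.\<close>

lemma finite_nbhd_diff:
  assumes "simple_graph G" "locally_finite G" "finite (boundary G D)"
  shows "finite (nbhd G j D - D)"
proof -
  have "nbhd G j D - D \<subseteq> (\<Union>x\<in>\<Union> (boundary G D). \<Union>n\<le>j. {u. (x, u) \<in> adj G ^^ n})"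
  proof
    fix v assume v: "v \<in> nbhd G j D - D"
    then obtain s n where s: "s \<in> D" "n \<le> j" "(v, s) \<in> adj G ^^ n" by (auto simp: mem_nbhd_iff)
    then obtain f where f: "f 0 = v" "f n = s" "\<And>i. i < n \<Longrightarrow> (f i, f (Suc i)) \<in> adj G"
      unfolding relpow_fun_conv by blast
    then obtain i where i: "i < n" "f i \<notin> D" "f (Suc i) \<in> D"
      using walk_crosses[of f "- D" n] v s(1) by auto
    have "{f i, f (Suc i)} \<in> edges G" using f(3)[OF i(1)] by (simp add: adj_def)
    then have "{f i, f (Suc i)} \<in> boundary G D"
      using edge_in_boundary_iff[OF assms(1)] i by simp
    moreover have "(f i, v) \<in> adj G ^^ i"
      using relpow_segment[of n f "adj G" 0 i] f i by (auto intro: relpow_adj_sym)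
    ultimately show "v \<in> (\<Union>x\<in>\<Union> (boundary G D). \<Union>n\<le>j. {u. (x, u) \<in> adj G ^^ n})"
      using i(1) s(2) by (intro UN_I[of "f i"] UN_I[of i]) auto
  qed
  moreover have "finite (\<Union>x\<in>\<Union> (boundary G D). \<Union>n\<le>j. {u. (x, u) \<in> adj G ^^ n})"
    using finite_Union_boundary[OF assms(1,3)] finite_sphere[OF assms(2)]
    by (intro finite_UN_I) auto
  ultimately show ?thesis by (rule finite_subset)
qed


section \<open>Existence of rays and of bi-infinite paths\<close>

text \<open>Koenig's argument along geodesics: \<open>d\<close> is the distance from \<open>v\<close>, and the ray is kept
  inside vertices with infinitely many geodesic descendants.\<close>

lemma exists_ray:
  fixes R :: "('a \<times> 'a) set"
  assumes fin: "\<And>x. finite {y. (x, y) \<in> R}" and inf: "infinite {z. (v, z) \<in> R\<^sup>*}"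
  shows "\<exists>r::nat \<Rightarrow> 'a. inj r \<and> (\<forall>n. (v, r n) \<in> R\<^sup>* \<and> (r n, r (Suc n)) \<in> R)"
proof -
  define d where "d u = (LEAST n. (v, u) \<in> R ^^ n)" for u
  \<comment> \<open>For \<open>x\<close> reachable from \<open>v\<close>, these are the ends of
    geodesics from \<open>v\<close> that pass through \<open>x\<close>.\<close>
  define Desc where "Desc x = {u. \<exists>m. (x, u) \<in> R ^^ m \<and> d u = d x + m}" for x
  have d: "(v, u) \<in> R ^^ d u" if "(v, u) \<in> R\<^sup>*" for u
    using that unfolding d_def rtrancl_power by (rule LeastI_ex)
  have d_le: "d b \<le> d a + m" if "(v, a) \<in> R\<^sup>*" "(a, b) \<in> R ^^ m" for a b m
    unfolding d_def[of b] by (rule Least_le) (use d[OF that(1)] that(2) in \<open>auto simp: relpow_add\<close>)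
  define P where "P n x \<longleftrightarrow> (v, x) \<in> R\<^sup>* \<and> d x = n \<and> infinite (Desc x)" for n x
  have step: "\<exists>y. P (Suc n) y \<and> (x, y) \<in> R" if "P n x" for n x
  proof (rule ccontr)
    assume neg: "\<not> ?thesis"
    define Y where "Y = {y. (x, y) \<in> R \<and> d y = Suc n}"
    have x: "(v, x) \<in> R\<^sup>*" "d x = n" "infinite (Desc x)" using that by (auto simp: P_def)
    have "finite (Desc y)" if "y \<in> Y" for y
      using neg x that by (auto simp: P_def Y_def intro: rtrancl_into_rtrancl)
    moreover have "finite Y" unfolding Y_def by (rule finite_subset[OF _ fin[of x]]) auto
    moreover have "Desc x \<subseteq> {x} \<union> (\<Union>y\<in>Y. Desc y)"
    proof
      fix u assume "u \<in> Desc x"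
      then obtain m where m: "(x, u) \<in> R ^^ m" "d u = d x + m" by (auto simp: Desc_def)
      show "u \<in> {x} \<union> (\<Union>y\<in>Y. Desc y)"
      proof (cases m)
        case (Suc l)
        then obtain y where y: "(x, y) \<in> R" "(y, u) \<in> R ^^ l" using m(1) by (metis relpow_Suc_D2)
        \<comment> \<open>The two bounds add up to the exact value of \<open>d u\<close>, so both
          are equalities and \<open>y\<close> again lies on a geodesic.\<close>
        then have "d y \<le> d x + 1" "d u \<le> d y + l"
          using d_le[of x y 1] d_le[of y u l] x(1) by (auto intro: rtrancl_into_rtrancl)
        then have "d y = Suc n" "d u = d y + l" using m(2) Suc x(2) by auto
        then show ?thesis using y by (auto simp: Y_def Desc_def)
      qed (use m in simp)
    qed
    ultimately have "finite (Desc x)" by (meson finite.emptyI finite_UN_I finite_Un finite_insert finite_subset)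
    with x(3) show False ..
  qed
  have "d v = 0" unfolding d_def by (rule Least_eq_0) simp
  moreover have "Desc v = {z. (v, z) \<in> R\<^sup>*}"
    using d \<open>d v = 0\<close> by (auto simp: Desc_def relpow_imp_rtrancl)
  ultimately have "\<exists>x. P 0 x" using inf by (auto simp: P_def)
  then obtain r where r: "\<And>n. P n (r n)" "\<And>n. (r n, r (Suc n)) \<in> R"
    using dependent_nat_choice[of P "\<lambda>n x y. (x, y) \<in> R"] step by blast
  \<comment> \<open>The distance of \<open>r n\<close> from \<open>v\<close> is exactly
    \<open>n\<close>.\<close>
  then have "inj r" unfolding P_def inj_def by metis
  with r show ?thesis by (auto simp: P_def)
qed

text \<open>Join the rays by a shortest walk between their vertex sets: it is a simple path that meets
  each ray only in an end point.\<close>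

lemma join_rays:
  assumes "connected_graph G" and r: "ray G r" and s: "ray G s" and disj: "range r \<inter> range s = {}"
  shows "\<exists>\<alpha>. biinfinite_path G \<alpha> \<and> (\<forall>S. tail_in r S \<longrightarrow> tail_in (bwd \<alpha>) S)
    \<and> (\<forall>S. tail_in s S \<longrightarrow> tail_in (fwd \<alpha>) S)"
proof -
  define P where "P n \<longleftrightarrow> (\<exists>i j. (r i, s j) \<in> adj G ^^ n)" for n
  have "(r 0, s 0) \<in> (adj G)\<^sup>*"
    using assms(1) ray_verts[OF r] ray_verts[OF s] by (simp add: connected_graph_def)
  then have "\<exists>n. P n" unfolding P_def rtrancl_power by blast
  define n where "n = (LEAST n. P n)"
  have "P n" using \<open>\<exists>n. P n\<close> unfolding n_def by (rule LeastI_ex)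
  then obtain i j where "(r i, s j) \<in> adj G ^^ n" by (auto simp: P_def)
  then obtain f where f: "f 0 = r i" "f n = s j" "\<And>p. p < n \<Longrightarrow> (f p, f (Suc p)) \<in> adj G"
    unfolding relpow_fun_conv by blast
  have least: "\<not> P p" if "p < n" for p using that unfolding n_def by (rule not_less_Least)
  have seg: "(f p, f q) \<in> adj G ^^ (q - p)" if "p \<le> q" "q \<le> n" for p q
    using relpow_segment[of n f "adj G" p q] f(3) that by simp
  have rs: "inj r" "inj s" "\<And>p. (r p, r (Suc p)) \<in> adj G" "\<And>p. (s p, s (Suc p)) \<in> adj G"
    using r s by (auto simp: ray_def)
  have ne: "r p \<noteq> s q" for p q using disj by blast
  have n0: "n > 0" using f ne[of i j] by (cases n) auto
  have f_r: "f p \<noteq> r q" if "0 < p" "p \<le> n" for p q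
  proof
    assume "f p = r q"
    then have "P (n - p)" using seg[of p n] that f(2) unfolding P_def by auto
    then show False using least[of "n - p"] that n0 by simp
  qed
  have f_s: "f p \<noteq> s q" if "p < n" for p q
  proof
    assume "f p = s q"
    then have "P p" using seg[of 0 p] that f(1) unfolding P_def by auto
    then show False using least that by simp
  qed
  \<comment> \<open>A repeated vertex would allow the loop between \<open>p\<close> and
    \<open>q\<close> to be cut out, giving a shorter joining walk.\<close>
  have f_f: "f p \<noteq> f q" if "p < q" "q \<le> n" for p q
  proof
    assume "f p = f q"
    then have "(r i, f p) \<in> adj G ^^ p" "(f p, s j) \<in> adj G ^^ (n - q)"
      using seg[of 0 p] seg[of q n] that f(1,2) by auto
    then have "(r i, s j) \<in> adj G ^^ (p + (n - q))" by (rule relpow_trans)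
    then have "P (p + (n - q))" unfolding P_def by blast
    moreover have "p + (n - q) < n" using that by linarith
    ultimately show False using least by blast
  qed
  \<comment> \<open>Index 0 carries \<open>f 0 = r i\<close> and index \<open>int n\<close> carries
    \<open>s j = f n\<close>; the segments of \<open>r\<close> before \<open>i\<close> and of
    \<open>s\<close> before \<open>j\<close> are discarded.\<close>
  define \<alpha> where "\<alpha> z = (if z < 0 then r (i + nat (- z)) else if z < int n then f (nat z)
    else s (j + nat (z - int n)))" for z
  have "\<alpha> x \<noteq> \<alpha> y" if "x < y" for x y
  proof -
    \<comment> \<open>The case \<open>y = 0\<close> is separate because \<open>f 0\<close> lies on
      \<open>r\<close>.\<close>
    consider "y < 0" | "x < 0" "y = 0" | "x < 0" "0 < y" "y < int n" | "x < 0" "int n \<le> y" 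
      | "0 \<le> x" "y < int n" | "0 \<le> x" "x < int n" "int n \<le> y" | "int n \<le> x"
      by (meson linorder_neqE_linordered_idom linorder_not_less)
    then show ?thesis
    proof cases
      case 1 then show ?thesis using that by (auto simp: \<alpha>_def inj_eq[OF rs(1)])
    next
      case 2 then show ?thesis using n0 f(1) by (auto simp: \<alpha>_def inj_eq[OF rs(1)])
    next
      case 3
      then have "f (nat y) \<noteq> r (i + nat (- x))" by (intro f_r) auto
      then show ?thesis using 3 by (simp add: \<alpha>_def)
    next
      case 4 then show ?thesis using ne by (auto simp: \<alpha>_def)
    next
      case 5 then show ?thesis using f_f[of "nat x" "nat y"] that by (auto simp: \<alpha>_def)
    next
      case 6 then show ?thesis using f_s[of "nat x"] by (auto simp: \<alpha>_def)
    next
      case 7 then show ?thesis using that by (auto simp: \<alpha>_def inj_eq[OF rs(2)])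
    qed
  qed
  then have "inj \<alpha>" by (metis injI linorder_neqE)
  moreover have step: "(\<alpha> z, \<alpha> (z + 1)) \<in> adj G" for z
  proof -
    consider "z < - 1" | "z = - 1" | "0 \<le> z" "z + 1 < int n" | "0 \<le> z" "z + 1 = int n" | "int n \<le> z"
      by linarith
    then show ?thesis
    proof cases
      case 1
      then have "i + nat (- z) = Suc (i + nat (- (z + 1)))" by simp
      then show ?thesis using 1 rs(3) sym_adj[of G] by (auto simp: \<alpha>_def dest: symD)
    next
      case 2 then show ?thesis using n0 f(1) rs(3)[of i] sym_adj[of G] by (auto simp: \<alpha>_def dest: symD)
    next
      case 3
      then have "nat (z + 1) = Suc (nat z)" by simp
      then show ?thesis using 3 f(3)[of "nat z"] by (auto simp: \<alpha>_def)
    next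
      case 4
      then have "n = Suc (nat z)" by simp
      then show ?thesis using 4 f(2) f(3)[of "nat z"] by (auto simp: \<alpha>_def)
    next
      case 5
      then have "nat (z + 1 - int n) = Suc (nat (z - int n))" by simp
      then show ?thesis using 5 rs(4)[of "j + nat (z - int n)"] by (auto simp: \<alpha>_def)
    qed
  qed
  moreover have "\<alpha> z \<in> verts G" for z using adj_verts[OF step] by simp
  ultimately have "biinfinite_path G \<alpha>" by (auto simp: biinfinite_path_def adj_def)
  moreover have "tail_in (bwd \<alpha>) S" if "tail_in r S" for S
  proof -
    obtain N where N: "\<And>m. m \<ge> N \<Longrightarrow> r m \<in> S" using \<open>tail_in r S\<close> by (auto simp: tail_in_iff)
    have "bwd \<alpha> m \<in> S" if "m \<ge> Suc N" for m using that N by (simp add: bwd_def \<alpha>_def)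
    then show ?thesis unfolding tail_in_iff by blast
  qed
  moreover have "tail_in (fwd \<alpha>) S" if "tail_in s S" for S
  proof -
    obtain N where N: "\<And>m. m \<ge> N \<Longrightarrow> s m \<in> S" using \<open>tail_in s S\<close> by (auto simp: tail_in_iff)
    have "fwd \<alpha> m \<in> S" if "m \<ge> N + n" for m using that N by (simp add: fwd_def \<alpha>_def)
    then show ?thesis unfolding tail_in_iff by blast
  qed
  ultimately show ?thesis by blast
qed


section \<open>Blocks\<close>

context
  fixes G :: "'a ugraph" and k :: nat
  assumes G: "simple_graph G" "connected_graph G" and acc: "accessible_with G k"
begin

section \<open>Equivalence classes of optimal cuts\<close>

lemma opt_class_opt: "D \<in> opt_class G k C \<Longrightarrow> D \<in> opt_cuts G k"
  by (simp add: opt_class_def opt_equiv_def)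

text \<open>Distinct members have disjoint complements. For members other than \<open>C\<close>,
  both complements lie properly in \<open>C\<close>. If \<open>D\<close> and \<open>D'\<close> were
  comparable, one complement would lie strictly between the other and \<open>C\<close>, against
  minimality; if \<open>D\<close> lay in the complement of \<open>D'\<close>, then \<open>C\<close>
  would be all of \<open>verts G\<close>.\<close>

lemma opt_class_compl_subset:
  assumes D: "D \<in> opt_class G k C" "D' \<in> opt_class G k C" "D \<noteq> D'"
  shows "compl_in G D \<subseteq> D'"
proof -
  note verts = opt_cut_verts[OF G acc] and compl = opt_cut_compl[OF G acc]
  have opt: "D \<in> opt_cuts G k" "D' \<in> opt_cuts G k" "C \<in> opt_cuts G k"
    using D by (auto simp: opt_class_def opt_equiv_def)
  have V: "D \<subseteq> verts G" "D' \<subseteq> verts G" "C \<subseteq> verts G" using opt verts by auto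
  have ne: "compl_in G C \<noteq> {}" using opt_cut_is_cut[OF G acc opt(3)] by (simp add: is_cut_def)
  show ?thesis
  proof (cases "D = C \<or> D' = C")
    case True
    then show ?thesis using D V unfolding opt_class_def opt_equiv_def by blast
  next
    case False
    have class_min: "compl_in G F \<subset> C
        \<and> (\<forall>E\<in>opt_cuts G k. compl_in G F \<subset> E \<and> E \<subseteq> C \<longrightarrow> C = E)"
      if "F \<in> opt_class G k C" "F \<noteq> C" for F
      using that by (simp add: opt_class_def opt_equiv_def)
    have sub: "compl_in G D \<subset> C" "compl_in G D' \<subset> C" using class_min D False by auto
    have min: "\<And>E. E \<in> opt_cuts G k \<Longrightarrow> compl_in G D \<subset> E \<Longrightarrow> E \<subseteq> C \<Longrightarrow> C = E"
        "\<And>E. E \<in> opt_cuts G k \<Longrightarrow> compl_in G D' \<subset> E \<Longrightarrow> E \<subseteq> C \<Longrightarrow> C = E"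
      using class_min[OF D(1)] class_min[OF D(2)] False by simp_all
    have "compl_in G D \<subseteq> compl_in G D' \<longleftrightarrow> D' \<subseteq> D" using V by blast
    moreover have "nested G D D'" by (rule opt_cuts_nested[OF G acc opt(1,2)])
    ultimately consider "D \<subseteq> D'" | "D \<subseteq> compl_in G D'" | "compl_in G D \<subseteq> D'" | "D' \<subseteq> D"
      unfolding nested_def by argo
    then show ?thesis
    proof cases
      case 1
      then have "compl_in G D' \<subset> compl_in G D" using D(3) V by blast
      then have "C = compl_in G D" using min(2)[OF compl[OF opt(1)]] sub by blast
      with sub show ?thesis by blast
    next
      case 2 then show ?thesis using sub ne V by blast
    next
      case 4
      then have "compl_in G D \<subset> compl_in G D'" using D(3) V by blast
      then have "C = compl_in G D'" using min(1)[OF compl[OF opt(2)]] sub by blast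
      with sub show ?thesis by blast
    qed
  qed
qed

lemma opt_class_member_avoiding:
  assumes C: "C \<in> opt_cuts G k" and E: "E \<in> opt_cuts G k" "E \<subset> C"
  shows "\<exists>F \<in> opt_class G k C. F \<subseteq> compl_in G E"
proof -
  note verts = opt_cut_verts[OF G acc] and compl = opt_cut_compl[OF G acc]
  define M where "M = {F \<in> opt_cuts G k. compl_in G C \<subset> F \<and> F \<subseteq> compl_in G E}"
  have V: "C \<subseteq> verts G" "E \<subseteq> verts G" using C E verts by auto
  \<comment> \<open>Every member of \<open>M\<close> contains \<open>u\<close> and avoids
    \<open>v\<close>, which makes \<open>M\<close> finite and a minimal member available.\<close>
  obtain u v where uv: "u \<in> compl_in G C" "v \<in> E"
    using opt_cut_is_cut[OF G acc C] opt_cut_is_cut[OF G acc E(1)] unfolding is_cut_def by blast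
  have "M \<subseteq> {F. is_k_cut G k F \<and> u \<in> F \<and> v \<notin> F}"
    using uv opt_cut_is_k_cut[OF G acc] by (auto simp: M_def)
  then have "finite M" by (rule finite_subset) (rule finite_k_cuts_separating[OF G], use uv V in blast)
  moreover have "compl_in G E \<in> M" using compl[OF E(1)] E V by (auto simp: M_def)
  ultimately obtain F where F: "F \<in> M" "\<And>F'. F' \<in> M \<Longrightarrow> F' \<subseteq> F \<Longrightarrow> F = F'"
    using finite_has_minimal[of M] by blast
  then have FV: "F \<subseteq> verts G" using verts by (auto simp: M_def)
  \<comment> \<open>Complementation turns minimality of \<open>F\<close> above
    \<open>compl_in G C\<close> into the required minimality of \<open>C\<close> above
    \<open>compl_in G F\<close>.\<close>
  have "C = E'" if E': "E' \<in> opt_cuts G k" "compl_in G F \<subset> E'" "E' \<subseteq> C" for E'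
  proof (rule ccontr)
    assume "C \<noteq> E'"
    then have "compl_in G C \<subset> compl_in G E'" using E'(3) V(1) by blast
    moreover have lt: "compl_in G E' \<subset> F" using E'(2) FV verts[OF E'(1)] by blast
    moreover have "F \<subseteq> compl_in G E" using F(1) by (simp add: M_def)
    ultimately have "compl_in G E' \<in> M" using compl[OF E'(1)] unfolding M_def by blast
    with lt show False using F(2)[of "compl_in G E'"] by blast
  qed
  moreover have "compl_in G F \<subset> C" using F(1) V FV unfolding M_def by blast
  ultimately have "F \<in> opt_class G k C" using F(1) C by (auto simp: opt_class_def opt_equiv_def M_def)
  then show ?thesis using F(1) by (auto simp: M_def)
qed

text \<open>Since both tails lie in \<open>C\<close>, both sides of \<open>E\<close> meet
  \<open>C\<close>, so nestedness puts one side of \<open>E\<close> properly inside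
  \<open>C\<close>. Some class member avoids that side, though it must contain the tail lying
  there.\<close>

lemma no_opt_cut_separates_class_tails:
  assumes C: "C \<in> opt_cuts G k" and E: "E \<in> opt_cuts G k"
    and tails: "\<And>D. D \<in> opt_class G k C \<Longrightarrow> tail_in r D \<and> tail_in s D"
  shows "\<not> (tail_in r E \<and> tail_in s (compl_in G E))"
proof
  assume rs: "tail_in r E \<and> tail_in s (compl_in G E)"
  have V: "C \<subseteq> verts G" "E \<subseteq> verts G" using opt_cut_verts[OF G acc] C E by auto
  have meet: "S \<inter> T \<noteq> {}" if "tail_in t S" "tail_in t T" for t :: "nat \<Rightarrow> 'a" and S T
    using that tail_in_nonempty[of t "S \<inter> T"] by (simp add: tail_in_Int)
  have "C \<in> opt_class G k C" using C by (simp add: opt_class_def opt_equiv_def)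
  note tC = tails[OF this]
  have "E \<inter> C \<noteq> {}" "compl_in G E \<inter> C \<noteq> {}" using meet[of r E C] meet[of s "compl_in G E" C] rs tC by auto
  moreover have "nested G E C" using opt_cuts_nested[OF G acc E C] .
  ultimately consider "E \<subset> C" | "compl_in G E \<subset> C"
    using V unfolding nested_def by blast
  then show False
  proof cases
    case 1
    from opt_class_member_avoiding[OF C E this] obtain F where "F \<in> opt_class G k C" "F \<subseteq> compl_in G E" by blast
    then show False using meet[of r E F] rs tails by blast
  next
    case 2
    from opt_class_member_avoiding[OF C opt_cut_compl[OF G acc E] this] obtain F
      where "F \<in> opt_class G k C" "F \<subseteq> compl_in G (compl_in G E)" by blast
    then show False using meet[of s "compl_in G E" F] rs tails by blast
  qed
qed

section \<open>Frontiers and the ends of a block\<close>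

context
  fixes \<kappa> :: nat and C :: "'a set"
  assumes lf: "locally_finite G" and \<kappa>: "\<kappa> \<ge> 1" and C: "C \<in> opt_cuts G k"
    and frontier_connected:
      "\<And>D. D \<in> opt_cuts G k \<Longrightarrow> connected_graph (induced G (nbhd G \<kappa> D \<inter> compl_in G D))"
begin

abbreviation (input) "B \<equiv> block G \<kappa> (opt_class G k C)"
abbreviation (input) "frontier D \<equiv> nbhd G \<kappa> D \<inter> compl_in G D"

lemma self_in_opt_class: "C \<in> opt_class G k C"
  using C by (simp add: opt_class_def opt_equiv_def)

lemma block_verts: "B \<subseteq> verts G"
  using self_in_opt_class nbhd_verts[of G \<kappa> C] by (auto simp: block_def)

text \<open>The frontier of \<open>D\<close> lies in the neighbourhood of \<open>D\<close> by
  definition, and in every other class member because that member contains the complement of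
  \<open>D\<close>.\<close>

lemma frontier_subset_block:
  assumes "D \<in> opt_class G k C" shows "frontier D \<subseteq> B"
  using assms opt_class_compl_subset[of D C] subset_nbhd[of _ G \<kappa>] opt_cut_verts[OF G acc] opt_class_opt
  unfolding block_def by blast

text \<open>If the frontier of \<open>D\<close> contains \<open>s\<close>, then \<open>D\<close>
  separates \<open>s\<close> from some vertex in the finite ball of radius \<kappa> around
  \<open>s\<close>, and only finitely many \<open>k\<close>-cuts separate a given pair.\<close>

lemma finite_frontiers_meeting:
  assumes "finite S" "S \<subseteq> verts G"
  shows "finite {D \<in> opt_class G k C. frontier D \<inter> S \<noteq> {}}"
proof -
  have sub: "{D \<in> opt_class G k C. frontier D \<inter> S \<noteq> {}}
    \<subseteq> (\<Union>s\<in>S. \<Union>n\<le>\<kappa>. \<Union>d\<in>{d. (s, d) \<in> adj G ^^ n}. {D. is_k_cut G k D \<and> d \<in> D \<and> s \<notin> D})"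
    using opt_cut_is_k_cut[OF G acc] opt_class_opt by (fastforce simp: mem_nbhd_iff)
  have "finite {D. is_k_cut G k D \<and> d \<in> D \<and> s \<notin> D}" if "s \<in> S" for s d
    using finite_k_cuts_separating[OF G] that assms(2) by blast
  then have "finite (\<Union>s\<in>S. \<Union>n\<le>\<kappa>. \<Union>d\<in>{d. (s, d) \<in> adj G ^^ n}.
      {D. is_k_cut G k D \<and> d \<in> D \<and> s \<notin> D})"
    using assms(1) finite_sphere[OF lf] by (intro finite_UN_I) auto
  with sub show ?thesis by (rule finite_subset)
qed

text \<open>A walk that leaves the block does so through the frontier of a single member of the class,
  stays beyond it, and returns through the same frontier, which is connected and lies in the block.\<close>

lemma walk_reroute:
  assumes "S \<subseteq> S'" 
    and S': "\<And>D. D \<in> opt_class G k C \<Longrightarrow> frontier D \<inter> S \<noteq> {} \<Longrightarrow> frontier D \<subseteq> S'"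
    and u: "u \<in> B" and walk: "(u, w) \<in> (adj G \<inter> (verts G - S') \<times> (verts G - S'))\<^sup>*"
  shows "(w \<in> B \<longrightarrow> (u, w) \<in> (adj G \<inter> (B - S) \<times> (B - S))\<^sup>*)
    \<and> (w \<notin> B \<longrightarrow> (\<exists>D \<in> opt_class G k C. w \<notin> nbhd G \<kappa> D
        \<and> (\<exists>x \<in> frontier D - S'. (u, x) \<in> (adj G \<inter> (B - S) \<times> (B - S))\<^sup>*)))"
  using walk
proof (induction rule: rtrancl_induct)
  case base then show ?case using u by simp
next
  case (step w z)
  let ?R = "(adj G \<inter> (B - S) \<times> (B - S))\<^sup>*"
  have wz: "(w, z) \<in> adj G" "(z, w) \<in> adj G" "w \<in> verts G" "z \<in> verts G" "w \<notin> S'" "z \<notin> S'"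
    using step(2) sym_adj[of G] by (auto dest: symD)
  have sub: "D \<subseteq> nbhd G \<kappa> D" if "D \<in> opt_class G k C" for D
    using subset_nbhd opt_cut_verts[OF G acc] opt_class_opt that by metis
  show ?case
  proof (cases "w \<in> B")
    case True
    then have uw: "(u, w) \<in> ?R" using step.IH by simp
    show ?thesis
    proof (cases "z \<in> B")
      case zB: True
      then have "(w, z) \<in> adj G \<inter> (B - S) \<times> (B - S)" using True wz assms(1) by blast
      with uw have "(u, z) \<in> ?R" by (rule rtrancl_into_rtrancl)
      then show ?thesis using zB by simp
    next
      case False
      then obtain D where D: "D \<in> opt_class G k C" "z \<notin> nbhd G \<kappa> D" by (auto simp: block_def)
      have "w \<notin> D" using neighbour_in_nbhd[OF wz(1) _ \<kappa>, of D] D(2) by blast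
      moreover have "w \<in> nbhd G \<kappa> D" using True D(1) by (auto simp: block_def)
      \<comment> \<open>Since \<kappa> is at least 1, a step out of the neighbourhood starts outside
        \<open>D\<close>; \<open>w\<close> is the recorded exit point.\<close>
      ultimately have "w \<in> frontier D - S'" using wz by simp
      then show ?thesis using False D uw by blast
    qed
  next
    case False
    then obtain D x where D: "D \<in> opt_class G k C" "w \<notin> nbhd G \<kappa> D"
      and x: "x \<in> frontier D - S'" "(u, x) \<in> ?R" using step.IH by blast
    have zD: "z \<notin> D" using neighbour_in_nbhd[OF wz(2) _ \<kappa>, of D] D(2) by blast
    show ?thesis
    proof (cases "z \<in> B")
      case True
      then have "z \<in> frontier D" using zD D(1) wz(4) by (auto simp: block_def)
      moreover have "verts G \<inter> frontier D = frontier D" by blast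
      ultimately have "(x, z) \<in> (adj G \<inter> frontier D \<times> frontier D)\<^sup>*"
        using frontier_connected[OF opt_class_opt[OF D(1)]] x(1)
        unfolding connected_graph_def verts_induced adj_induced by (metis DiffD1)
      \<comment> \<open>The exit point lies outside \<open>S'\<close>, so this frontier was not
        added to \<open>S'\<close> and therefore misses \<open>S\<close>.\<close>
      moreover have "frontier D \<subseteq> B - S" using frontier_subset_block[OF D(1)] S'[OF D(1)] x(1) by blast
      then have "(adj G \<inter> frontier D \<times> frontier D)\<^sup>* \<subseteq> ?R" by (intro rtrancl_mono) blast
      ultimately have "(u, z) \<in> ?R" using x(2) by (meson rtrancl_trans subsetD)
      then show ?thesis using True by simp
    next
      case zB: False
      have "z \<notin> nbhd G \<kappa> D"
      proof
        assume "z \<in> nbhd G \<kappa> D"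
        then have "z \<in> frontier D" using zD wz(4) by simp
        then show False using frontier_subset_block[OF D(1)] zB by blast
      qed
      then show ?thesis using zB D(1) x by blast
    qed
  qed
qed

text \<open>The block lies in \<open>nbhd G \<kappa> D\<close>, which exceeds \<open>D\<close> by a
  finite set only, and an injective sequence eventually leaves finite sets.\<close>

lemma tail_in_class_member:
  assumes "inj r" "tail_in r B" "D \<in> opt_class G k C"
  shows "tail_in r D"
proof -
  have "finite (boundary G D)"
    using opt_cut_is_cut[OF G acc opt_class_opt[OF assms(3)]] by (simp add: is_cut_def)
  then have "tail_in r (B - (nbhd G \<kappa> D - D))"
    using tail_avoids_finite[OF assms(1) finite_nbhd_diff[OF G(1) lf] assms(2)] by blast
  moreover have "B - (nbhd G \<kappa> D - D) \<subseteq> D" using assms(3) by (auto simp: block_def)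
  ultimately show ?thesis by (rule tail_in_mono)
qed

text \<open>An edge leaving the component ends in \<open>F\<close>, whose vertices have finite
  degree.\<close>

lemma finite_boundary_component_diff:
  assumes "finite F" "x \<in> verts G - F"
  shows "finite (boundary G (component G (verts G - F) x))" (is "finite (boundary G ?P)")
proof -
  have "boundary G ?P \<subseteq> (\<Union>s\<in>F. (\<lambda>u. {s, u}) ` {u. (s, u) \<in> adj G})"
  proof
    fix e assume "e \<in> boundary G ?P"
    then obtain a b where e: "e = {a, b}" "{a, b} \<in> edges G" "a \<in> ?P" "b \<in> verts G - ?P"
      by (auto simp: boundary_def)
    have a: "a \<in> verts G - F" using component_subset[OF assms(2), of G] e(3) by blast
    then have ab: "(a, b) \<in> adj G" using e by (simp add: adj_def)
    have "b \<in> F" using component_closed[OF e(3) ab a] e(4) by blast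
    moreover have "(b, a) \<in> adj G" using ab sym_adj[of G] by (auto dest: symD)
    ultimately show "e \<in> (\<Union>s\<in>F. (\<lambda>u. {s, u}) ` {u. (s, u) \<in> adj G})"
      unfolding e(1) by (auto simp: insert_commute)
  qed
  moreover have "finite (\<Union>s\<in>F. (\<lambda>u. {s, u}) ` {u. (s, u) \<in> adj G})"
    using assms(1) finite_neighbours[OF lf] by blast
  ultimately show ?thesis by (rule finite_subset)
qed

lemma block_tails_not_separable:
  assumes \<alpha>: "biinfinite_path G \<alpha>" and tails: "tail_in (fwd \<alpha>) B" "tail_in (bwd \<alpha>) B"
  shows "path_cuts G \<alpha> = {}"
proof (rule ccontr)
  assume "path_cuts G \<alpha> \<noteq> {}"
  then obtain E where "E \<in> path_opt_cuts G k \<alpha>" using path_opt_cuts_nonempty by blast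
  then have E: "E \<in> opt_cuts G k" and "E \<in> path_cuts G \<alpha>"
    using \<alpha> by (auto simp: opt_cuts_def path_opt_cuts_def min_cuts_def)
  then have sep: "separates E \<alpha>" and fin: "finite (boundary G E)"
    using path_cuts_iff[OF G(1) \<alpha>] by (auto simp: is_cut_def)
  note rays = ray_fwd_bwd[OF \<alpha>]
  then have inj: "inj (fwd \<alpha>)" "inj (bwd \<alpha>)" by (auto simp: ray_def)
  have tD: "tail_in (fwd \<alpha>) D" "tail_in (bwd \<alpha>) D" if "D \<in> opt_class G k C" for D
    using tail_in_class_member inj tails that by auto
  have "\<not> (tail_in (fwd \<alpha>) E \<and> tail_in (bwd \<alpha>) (compl_in G E))"
    "\<not> (tail_in (bwd \<alpha>) E \<and> tail_in (fwd \<alpha>) (compl_in G E))"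
    using no_opt_cut_separates_class_tails[OF C E, of "fwd \<alpha>" "bwd \<alpha>"]
      no_opt_cut_separates_class_tails[OF C E, of "bwd \<alpha>" "fwd \<alpha>"] tD by blast+
  then show False
    using sep ray_tail_dichotomy[OF G(1) rays(1) fin] ray_tail_dichotomy[OF G(1) rays(2) fin]
    by (auto simp: separates_def)
qed

lemma block_at_most_one_end: "at_most_one_end (induced G B)"
proof
  assume "more_than_one_end (induced G B)"
  then obtain S A A' where S: "S \<subseteq> verts G \<inter> B" "finite S"
    and A: "A \<in> graph_components (induced (induced G B) (verts G \<inter> B - S))" "infinite A"
    and A': "A' \<in> graph_components (induced (induced G B) (verts G \<inter> B - S))" "infinite A'"
    and ne: "A \<noteq> A'"
    unfolding more_than_one_end_def verts_induced by blast
  define R where "R = adj G \<inter> (B - S) \<times> (B - S)"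
  have adjR: "adj (induced (induced G B) (verts G \<inter> B - S)) = R"
    using block_verts unfolding adj_induced R_def by blast
  have symR: "sym (R\<^sup>*)" unfolding R_def by (rule sym_rtrancl_adj_within)
  obtain a where a: "A = {u. (a, u) \<in> R\<^sup>*}" "a \<in> B - S"
    using A(1) unfolding graph_components_def adjR by auto
  obtain a' where a': "A' = {u. (a', u) \<in> R\<^sup>*}" "a' \<in> B - S"
    using A'(1) unfolding graph_components_def adjR by auto
  have disj: "(a', u) \<notin> R\<^sup>*" if "(a, u) \<in> R\<^sup>*" for u
  proof
    assume "(a', u) \<in> R\<^sup>*"
    then have aa': "(a, a') \<in> R\<^sup>*" "(a', a) \<in> R\<^sup>*" using that symD[OF symR] by (blast intro: rtrancl_trans)+
    then have "A = A'" unfolding a a' by (blast intro: rtrancl_trans)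
    with ne show False ..
  qed
  have finR: "finite {y. (x, y) \<in> R}" for x
    by (rule finite_subset[OF _ finite_neighbours[OF lf, of x]]) (auto simp: R_def)
  obtain r where r: "inj r" "\<And>n. (a, r n) \<in> R\<^sup>*" "\<And>n. (r n, r (Suc n)) \<in> R"
    using exists_ray[OF finR, of a] A(2) a(1) by blast
  obtain s where s: "inj s" "\<And>n. (a', s n) \<in> R\<^sup>*" "\<And>n. (s n, s (Suc n)) \<in> R"
    using exists_ray[OF finR, of a'] A'(2) a'(1) by blast
  have rays: "ray G r" "ray G s" using r s by (auto simp: ray_def R_def)
  have rB: "tail_in r B" "tail_in s B" using r(3) s(3) by (auto simp: tail_in_iff R_def)
  have "r n \<noteq> s m" for n m using disj[OF r(2)[of n]] s(2)[of m] by auto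
  then have "range r \<inter> range s = {}" by blast
  then obtain \<alpha> where \<alpha>: "biinfinite_path G \<alpha>" "\<And>S. tail_in r S \<Longrightarrow> tail_in (bwd \<alpha>) S"
    "\<And>S. tail_in s S \<Longrightarrow> tail_in (fwd \<alpha>) S"
    using join_rays[OF G(2) rays] by blast
  \<comment> \<open>The extra frontiers guarantee that every frontier not swallowed by
    \<open>S'\<close> is disjoint from \<open>S\<close> and so usable for rerouting.\<close>
  define S' where "S' = S \<union> \<Union> (frontier ` {D \<in> opt_class G k C. frontier D \<inter> S \<noteq> {}})"
  have "finite (frontier D)" if "D \<in> opt_class G k C" for D
  proof -
    have "frontier D = nbhd G \<kappa> D - D" using nbhd_verts[of G \<kappa> D] by blast
    then show ?thesis
      using finite_nbhd_diff[OF G(1) lf, of D] opt_cut_is_cut[OF G acc opt_class_opt[OF that]]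
      by (simp add: is_cut_def)
  qed
  then have finS': "finite S'" using S finite_frontiers_meeting[of S] by (auto simp: S'_def)
  have S': "S \<subseteq> S'" "\<And>D. D \<in> opt_class G k C \<Longrightarrow> frontier D \<inter> S \<noteq> {} \<Longrightarrow> frontier D \<subseteq> S'"
    by (auto simp: S'_def)
  have "tail_in r (B - S')" using tail_avoids_finite[OF r(1) finS' rB(1)] .
  then obtain N where N: "\<And>n. n \<ge> N \<Longrightarrow> r n \<in> B - S'" by (auto simp: tail_in_iff)
  define P where "P = component G (verts G - S') (r N)"
  have rN: "r N \<in> verts G - S'" using N[of N] block_verts by blast
  have tr: "tail_in r P" unfolding P_def
    by (rule ray_tail_in_component[OF rays(1)]) (use N block_verts in blast)
  \<comment> \<open>A walk from \<open>r N\<close> to \<open>s n\<close> avoiding \<open>S'\<close>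
    could be rerouted inside \<open>B - S\<close>, joining the two components of the block.\<close>
  have "s n \<in> compl_in G P" if "s n \<in> B - S'" for n
  proof (rule ccontr)
    assume "s n \<notin> compl_in G P"
    then have "s n \<in> P" using that block_verts by blast
    then have "(r N, s n) \<in> (adj G \<inter> (verts G - S') \<times> (verts G - S'))\<^sup>*" by (simp add: P_def component_def)
    then have "(r N, s n) \<in> R\<^sup>*" using walk_reroute[OF S' _, of "r N" "s n"] N[of N] that by (simp add: R_def)
    then have "(a, s n) \<in> R\<^sup>*" using r(2) rtrancl_trans by metis
    then show False using disj s(2) by blast
  qed
  then have ts: "tail_in s (compl_in G P)"
    using tail_avoids_finite[OF s(1) finS' rB(2)] unfolding tail_in_iff by blast
  have finP: "finite (boundary G P)"
    unfolding P_def by (rule finite_boundary_component_diff[OF finS' rN])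
  have "separates P \<alpha>"
    using \<alpha>(2)[OF tr] \<alpha>(3)[OF ts] ray_tail_dichotomy[OF G(1) ray_fwd_bwd(1)[OF \<alpha>(1)] finP]
    by (simp add: separates_def)
  moreover have "P \<subseteq> verts G" using component_subset[OF rN, of G] by (auto simp: P_def)
  ultimately have "path_cuts G \<alpha> \<noteq> {}" using exists_path_cut_below[OF G \<alpha>(1) _ finP] by blast
  then show False using block_tails_not_separable[OF \<alpha>(1)] \<alpha>(2)[OF rB(1)] \<alpha>(3)[OF rB(2)] by blast
qed

end

end

theorem proposition4p8:
  fixes G :: "'a ugraph" and k \<kappa> :: nat and C :: "'a set"
  assumes "simple_graph G"
    and "connected_graph G"
    and "locally_finite G"
    and "accessible G"
    and "finite (aut_orbits G)"
    and "accessible_with G k"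
    and "\<kappa> \<ge> 1"
    and "\<And>D. D \<in> opt_cuts G k \<Longrightarrow> connected_graph (induced G (nbhd G \<kappa> D \<inter> compl_in G D))"
    and "C \<in> opt_cuts G k"
  shows "at_most_one_end (induced G (block G \<kappa> (opt_class G k C)))"
  using block_at_most_one_end[OF assms(1,2,6,3,7,9,8)] .

end
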